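(* Fix $r$ and the network $\mathcal N^r$ with initial condition $q^r\in\mathbb R_+^{\mathbf I}$ (the superscript $r$ is suppressed on $T,E,S,Q,I,\boldsymbol\Phi,u,v,\xi,\eta$). Let $T$ be a control policy for $\mathcal N^r$ such that (i) each $T_j$ is nondecreasing, nonnegative, $T_j(0)=0$; (ii) each $I_k$ is nondecreasing, nonnegative, $I_k(0)=0$; (iii) each $Q_i$ is nonnegative; and, in addition: (a) there is a $\mathbf J$-dimensional measurable process $\dot T$ with values in $\{0,1\}$ in each component such that $T(t)=\int_0^t\dot T(s)\,ds$ for all $t\in[0,\infty)$; (b) for all $\ell\in\{0,1,2,\dots\}$, $\dot T(t)=\dot T(\Upsilon_\ell)$ for all $t\in[\Upsilon_\ell,\Upsilon_{\ell+1})$; (c) for all $\ell\ge0$, $\dot T(\Upsilon_\ell)$ is a measurable function of $\chi^\ell$. Then for each $t\ge0$, $$\sigma_0^r(t)=\big(E_i(r^2t)+1,\ i=1,\dots,\mathbf I;\ S_j(T_j(r^2t))+1,\ j=1,\dots,\mathbf J\big)$$ is an $\{\mathcal F^r((m,n)):m\in\mathbb N^{\mathbf I},n\in\mathbb N^{\mathbf J}\}$ stopping time, and $\hat U^r$ is adapted to the filtration $\mathcal F_1^r(t)=\mathcal F^r(\sigma_0^r(t))$, $t\ge0$.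
   Context: $\mathbb N=\{1,2,\dots\}$; inequalities between vectors are componentwise. **Network.** Fix integers $\mathbf I,\mathbf J,\mathbf K\ge1$ (numbers of buffers, activities, servers) and $\mathbf I'\le\mathbf I$. $C$ is an $\mathbf I\times\mathbf J$ and $A$ a $\mathbf K\times\mathbf J$ zero-one matrix ($C_{ij}=1$ iff activity $j$ processes buffer $i$; $A_{kj}=1$ iff server $k$ performs activity $j$); each column of $C$ and of $A$ has exactly one $1$, each row at least one $1$, and there is at most one activity per buffer–server pair. The index $r$ ranges over a fixed sequence $1\le r_1<r_2<\cdots\to\infty$. On a probability space $(\Omega,\mathcal F,\mathbb P)$, for each $r$ (network $\mathcal N^r$): for $i\le\mathbf I'$, $\{u_i^r(n)\}_{n\ge1}$ are i.i.d., a.s. strictly positive (interarrival times), with mean $1/\alpha_i^r$ and standard deviation $\sigma_i^{u,r}\in(0,\infty)$; for $\mathbf I'<i\le\mathbf I$, $\alpha_i^r=\sigma_i^{u,r}=0$ and $u_i^r(n)=\infty$; for $j\le\mathbf J$, $\{v_j^r(n)\}_{n\ge1}$ are i.i.d., a.s. strictly positive (service times), with mean $1/\beta_j^r$ and standard deviation $\sigma_j^{v,r}\in(0,\infty)$; $(\phi_0^{j,r}(n),\phi^{j,r}(n))$, $n\ge1$, $\phi^{j,r}(n)=(\phi_i^{j,r}(n))_{i=1}^{\mathbf I}$, are i.i.d. one-trial multinomial vectors with probabilities $(p_0^j,p^j)$, $p^j=(p_i^j)_{i=1}^{\mathbf I}$ (routing). All these sequences are mutually independent. The families $\{(u_i^r(1))^2\}_r$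 ($i\le\mathbf I'$) and $\{(v_j^r(1))^2\}_r$ are uniformly integrable. Put $\xi_i^r(m)=\sum_{n\le m}u_i^r(n)$, $\eta_j^r(m)=\sum_{n\le m}v_j^r(n)$, $\xi_i^r(0)=\eta_j^r(0)=0$, $E_i^r(t)=\max\{m\ge0:\xi_i^r(m)\le t\}$, $S_j^r(t)=\max\{m\ge0:\eta_j^r(m)\le t\}$, $\boldsymbol\Phi_i^{j,r}(n)=\sum_{m=1}^n\phi_i^{j,r}(m)$. **Parameters and heavy traffic (standing).** There are nonnegative $q,\alpha,\sigma^u,\theta_1\in\mathbb R^{\mathbf I}$ and $\beta,\sigma^v,\theta_2\in\mathbb R^{\mathbf J}$ with $\beta>0$, $\sigma^v>0$, $\alpha_i=0$ and $\sigma^u_i=0$ exactly for $i>\mathbf I'$, such that $r(\alpha^r-\alpha)\to\theta_1$, $r(\beta^r-\beta)\to\theta_2$, $\sigma^{u,r}\to\sigma^u$, $\sigma^{v,r}\to\sigma^v$, $q^r/r\to q$ as $r\to\infty$. With $P'_{ij}=p_i^j$ and $R=(C-P')\operatorname{diag}(\beta)$, the linear program: minimize $\rho$ subject to $Rx=\alpha$, $Ax\le\rho e$, $x\ge0$ ($e$ = vector of ones) has a unique optimal solution $(x^*,\rho^* )$, and $\rho^*=1$, $Ax^*=e$. Activities are labelled so that the first $\mathbf B$ components of $x^*$ are positive and the others are $0$; $A=[B:N]$ with $B$ of size $\mathbf K\times\mathbf B$. Let $K=\begin{bmatrix}B&N\\0&-\mathbb I\end{bmatrix}$, of size $(\mathbf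 K+\mathbf J-\mathbf B)\times\mathbf J$. **Policies.** A control policy is a nonnegative, nondecreasing $\mathbf J$-dimensional process $T^r$ ($T_j^r(t)$ is the cumulative time spent on activity $j$ up to $t$); with it are associated $$Q_i^r(t)=q_i^r+E_i^r(t)-\sum_jC_{ij}S_j^r(T_j^r(t))+\sum_j\boldsymbol\Phi_i^{j,r}(S_j^r(T_j^r(t))),\qquad I_k^r(t)=t-\sum_jA_{kj}T_j^r(t),$$ $Y^r(t)=x^*t-T^r(t)$, $U^r=KY^r$, $\hat U^r(t)=r^{-1}U^r(r^2t)$. **Multiparameter filtration.** For $(m,n)\in\mathbb N^{\mathbf I}\times\mathbb N^{\mathbf J}$ let $\mathcal F^r((m,n))=\sigma\{u_i^r(m_i'),v_j^r(n_j'),\phi_i^{j,r}(n_j'):m_i'\le m_i,n_j'\le n_j,\ i\le\mathbf I,\ j\le\mathbf J\}$ and $\mathcal F^r=\sigma(\bigcup_{(m,n)}\mathcal F^r((m,n)))$. A random variable $\sigma$ with values in $\mathbb N^{\mathbf I+\mathbf J}$ is a stopping time if $\{\sigma\le(m,n)\}\in\mathcal F^r((m,n))$ for all $(m,n)$; then $\mathcal F^r(\sigma)=\{F\in\mathcal F^r:F\cap\{\sigma\le(m,n)\}\in\mathcal F^r((m,n))\ \forall(m,n)\}$. **Event times and histories.** $\Upsilon_0=0$ and, for $\ell\ge0$, $\Upsilon_{\ell+1}$ is the first time after $\Upsilon_\ell$ at which an exogenous arrival or a service completion takes place (several events may occur at the same $\Upsilon_\ell$); almost surely $\{\Upsilon_\ell\}$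 is strictly increasing to $\infty$. For $i\le\mathbf I$, $j\le\mathbf J$, $\ell\ge0$: $u_i^\ell=\xi_i(E_i(\Upsilon_\ell)+1)-\Upsilon_\ell$ (residual arrival time), $v_j^\ell=\eta_j(S_j(T_j(\Upsilon_\ell))+1)-T_j(\Upsilon_\ell)$ (residual service time), $Q_i^0=0$, $Q_i^\ell=Q_i(\Upsilon_\ell)$ for $\ell\ge1$, $\dot T_j^\ell=\dot T_j(\Upsilon_\ell)$, $\dot T_j^{-1}=0$, and $$\chi^\ell=\{(\Upsilon_{\ell'},u_i^{\ell'},v_j^{\ell'},Q_i^{\ell'},\dot T_j^{\ell'-1}:i=1,\dots,\mathbf I,\ j=1,\dots,\mathbf J):\ell'=0,\dots,\ell\}.$$
   Formalization: Since interarrival and service times are only a.s. positive, the claim can fail on null sets for the bare filtration; it is proved for the filtration augmented by null sets, or for the bare one when positivity, divergence of the sums and all policy conditions hold at every sample point. *)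

theory Defs
  imports "HOL-Probability.Probability" "Jordan_Normal_Form.Matrix"
begin

unbundle no vec_syntax

text \<open>
  Conventions.  Buffers, activities and servers are numbered from 0, so that the exogenous buffers
  are the \<open>i < exo N\<close> and the basic activities the \<open>j < basic N\<close>.  The sample index \<open>n\<close> of the
  primitive sequences starts at 1; their values at \<open>n = 0\<close> are never used.  Everything that depends
  on the scaling parameter \<open>r\<close> takes it as a real argument, which is only meaningful for
  \<open>r \<in> range (rseq N)\<close>.  Vectors and matrices are those of \<open>Jordan_Normal_Form\<close>, whose order on
  vectors is componentwise.  A routing vector has one component \<open>Some i\<close> for every buffer \<open>i\<close> and
  the component \<open>None\<close> (written 0 in the usual notation) for leaving the network.
\<close>

record 'w network =
  prob_sp :: "'w measure"
  buffers :: nat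
  exo :: nat
  activities :: nat
  servers :: nat
  basic :: nat
  Cmat :: "real mat"
  Amat :: "real mat"
  rseq :: "nat \<Rightarrow> real"
  arrival_time :: "real \<Rightarrow> nat \<Rightarrow> nat \<Rightarrow> 'w \<Rightarrow> real" \<comment> \<open>only used for exogenous buffers, see \<open>interarrival\<close>\<close>
  service_time :: "real \<Rightarrow> nat \<Rightarrow> nat \<Rightarrow> 'w \<Rightarrow> real"
  routing :: "real \<Rightarrow> nat \<Rightarrow> nat \<Rightarrow> nat option \<Rightarrow> 'w \<Rightarrow> nat"
  routing_prob :: "nat \<Rightarrow> nat option \<Rightarrow> real"
  alpha_r :: "real \<Rightarrow> real vec"
  sigma_u_r :: "real \<Rightarrow> real vec"
  beta_r :: "real \<Rightarrow> real vec"
  sigma_v_r :: "real \<Rightarrow> real vec"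
  q_r :: "real \<Rightarrow> real vec"
  alpha :: "real vec"
  sigma_u :: "real vec"
  theta1 :: "real vec"
  q_lim :: "real vec"
  beta :: "real vec"
  sigma_v :: "real vec"
  theta2 :: "real vec"
  x_star :: "real vec"
  rho_star :: real

abbreviation \<Omega> :: "'w network \<Rightarrow> 'w set" where
  "\<Omega> N \<equiv> space (prob_sp N)"

subsection \<open>Network structure and primitives\<close>

definition network_structure :: "'w network \<Rightarrow> bool" where
  "network_structure N \<longleftrightarrow>
     1 \<le> buffers N \<and> 1 \<le> activities N \<and> 1 \<le> servers N \<and> exo N \<le> buffers N \<and>
     Cmat N \<in> carrier_mat (buffers N) (activities N) \<and>
     Amat N \<in> carrier_mat (servers N) (activities N) \<and>
     (\<forall>i<buffers N. \<forall>j<activities N. Cmat N $$ (i, j) \<in> {0, 1}) \<and>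
     (\<forall>k<servers N. \<forall>j<activities N. Amat N $$ (k, j) \<in> {0, 1}) \<and>
     (\<forall>j<activities N. \<exists>!i. i < buffers N \<and> Cmat N $$ (i, j) = 1) \<and>
     (\<forall>j<activities N. \<exists>!k. k < servers N \<and> Amat N $$ (k, j) = 1) \<and>
     (\<forall>i<buffers N. \<exists>j<activities N. Cmat N $$ (i, j) = 1) \<and>
     (\<forall>k<servers N. \<exists>j<activities N. Amat N $$ (k, j) = 1) \<and>
     (\<forall>i<buffers N. \<forall>k<servers N. \<forall>j<activities N. \<forall>j'<activities N.
        Cmat N $$ (i, j) = 1 \<and> Amat N $$ (k, j) = 1 \<and>
        Cmat N $$ (i, j') = 1 \<and> Amat N $$ (k, j') = 1 \<longrightarrow> j = j') \<and>
     strict_mono (rseq N) \<and> 1 \<le> rseq N 0 \<and> filterlim (rseq N) at_top sequentially"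

definition iid :: "'w measure \<Rightarrow> 'b measure \<Rightarrow> (nat \<Rightarrow> 'w \<Rightarrow> 'b) \<Rightarrow> bool" where
  "iid M L X \<longleftrightarrow>
     prob_space.indep_vars M (\<lambda>_. L) X {1..} \<and> (\<forall>n\<ge>1. distr M L (X n) = distr M L (X 1))"

definition seq_sigma :: "'w measure \<Rightarrow> 'b measure \<Rightarrow> (nat \<Rightarrow> 'w \<Rightarrow> 'b) \<Rightarrow> 'w set set" where
  "seq_sigma M L X =
     sigma_sets (space M) {X n -` B \<inter> space M | n B. 1 \<le> n \<and> B \<in> sets L}"

definition uniformly_integrable :: "'w measure \<Rightarrow> ('r \<Rightarrow> 'w \<Rightarrow> real) \<Rightarrow> 'r set \<Rightarrow> bool" where
  "uniformly_integrable M X R \<longleftrightarrow>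
     (\<forall>r\<in>R. integrable M (X r)) \<and>
     (\<forall>\<epsilon>>0. \<exists>c. \<forall>r\<in>R. (LINT \<omega>:{\<omega> \<in> space M. c < \<bar>X r \<omega>\<bar>}|M. \<bar>X r \<omega>\<bar>) < \<epsilon>)"

definition has_mean_sd :: "'w measure \<Rightarrow> ('w \<Rightarrow> real) \<Rightarrow> real \<Rightarrow> real \<Rightarrow> bool" where
  "has_mean_sd M X \<mu> s \<longleftrightarrow>
     integrable M X \<and> integrable M (\<lambda>\<omega>. (X \<omega>)\<^sup>2) \<and>
     (LINT \<omega>|M. X \<omega>) = \<mu> \<and> sqrt (LINT \<omega>|M. (X \<omega> - \<mu>)\<^sup>2) = s"

definition dests :: "'w network \<Rightarrow> nat option set" where
  "dests N = insert None (Some ` {..<buffers N})"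

definition routing_vec :: "'w network \<Rightarrow> real \<Rightarrow> nat \<Rightarrow> nat \<Rightarrow> 'w \<Rightarrow> nat option \<Rightarrow> nat" where
  "routing_vec N r j n \<omega> = (\<lambda>d\<in>dests N. routing N r j n d \<omega>)"

definition routing_space :: "'w network \<Rightarrow> (nat option \<Rightarrow> nat) measure" where
  "routing_space N = (\<Pi>\<^sub>M d\<in>dests N. count_space UNIV)"

datatype source = Arrivals nat | Services nat | Routings nat

fun source_sigma :: "'w network \<Rightarrow> real \<Rightarrow> source \<Rightarrow> 'w set set" where
  "source_sigma N r (Arrivals i) = seq_sigma (prob_sp N) borel (arrival_time N r i)"
| "source_sigma N r (Services j) = seq_sigma (prob_sp N) borel (service_time N r j)"
| "source_sigma N r (Routings j) = seq_sigma (prob_sp N) (routing_space N) (routing_vec N r j)"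

definition arrival_primitives :: "'w network \<Rightarrow> real \<Rightarrow> bool" where
  "arrival_primitives N r \<longleftrightarrow>
     alpha_r N r \<in> carrier_vec (buffers N) \<and> sigma_u_r N r \<in> carrier_vec (buffers N) \<and>
     (\<forall>i<exo N.
        iid (prob_sp N) borel (arrival_time N r i) \<and>
        (\<forall>n\<ge>1. AE \<omega> in prob_sp N. 0 < arrival_time N r i n \<omega>) \<and>
        0 < alpha_r N r $ i \<and> 0 < sigma_u_r N r $ i \<and>
        has_mean_sd (prob_sp N) (arrival_time N r i 1) (1 / alpha_r N r $ i) (sigma_u_r N r $ i)) \<and>
     (\<forall>i. exo N \<le> i \<and> i < buffers N \<longrightarrow> alpha_r N r $ i = 0 \<and> sigma_u_r N r $ i = 0)"

definition service_primitives :: "'w network \<Rightarrow> real \<Rightarrow> bool" where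
  "service_primitives N r \<longleftrightarrow>
     beta_r N r \<in> carrier_vec (activities N) \<and> sigma_v_r N r \<in> carrier_vec (activities N) \<and>
     (\<forall>j<activities N.
        iid (prob_sp N) borel (service_time N r j) \<and>
        (\<forall>n\<ge>1. AE \<omega> in prob_sp N. 0 < service_time N r j n \<omega>) \<and>
        0 < beta_r N r $ j \<and> 0 < sigma_v_r N r $ j \<and>
        has_mean_sd (prob_sp N) (service_time N r j 1) (1 / beta_r N r $ j) (sigma_v_r N r $ j))"

definition routing_primitives :: "'w network \<Rightarrow> real \<Rightarrow> bool" where
  "routing_primitives N r \<longleftrightarrow>
     (\<forall>j<activities N.
        iid (prob_sp N) (routing_space N) (routing_vec N r j) \<and>
        (\<forall>d\<in>dests N. 0 \<le> routing_prob N j d) \<and> (\<Sum>d\<in>dests N. routing_prob N j d) = 1 \<and>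
        (\<forall>n\<ge>1. \<forall>d\<in>dests N.
           measure (prob_sp N)
             {\<omega> \<in> \<Omega> N. \<forall>d'\<in>dests N. routing N r j n d' \<omega> = (if d' = d then 1 else 0)}
           = routing_prob N j d))"

definition network_primitives :: "'w network \<Rightarrow> bool" where
  "network_primitives N \<longleftrightarrow>
     prob_space (prob_sp N) \<and>
     (\<forall>r\<in>range (rseq N).
        arrival_primitives N r \<and> service_primitives N r \<and> routing_primitives N r \<and>
        prob_space.indep_sets (prob_sp N) (source_sigma N r)
          (Arrivals ` {..<exo N} \<union> Services ` {..<activities N} \<union> Routings ` {..<activities N}) \<and>
        q_r N r \<in> carrier_vec (buffers N) \<and> 0\<^sub>v (buffers N) \<le> q_r N r) \<and>
     (\<forall>i<exo N. uniformly_integrable (prob_sp N)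
        (\<lambda>r \<omega>. (arrival_time N r i 1 \<omega>)\<^sup>2) (range (rseq N))) \<and>
     (\<forall>j<activities N. uniformly_integrable (prob_sp N)
        (\<lambda>r \<omega>. (service_time N r j 1 \<omega>)\<^sup>2) (range (rseq N)))"

subsection \<open>Parameters and heavy traffic\<close>

definition routing_mat :: "'w network \<Rightarrow> real mat" where
  "routing_mat N = mat (buffers N) (activities N) (\<lambda>(i, j). routing_prob N j (Some i))"

definition Rmat :: "'w network \<Rightarrow> real mat" where
  "Rmat N = (Cmat N - routing_mat N) * mat_diag (activities N) (\<lambda>j. beta N $ j)"

abbreviation ones :: "nat \<Rightarrow> real vec" where
  "ones n \<equiv> vec n (\<lambda>_. 1)"

definition lp_feasible :: "'w network \<Rightarrow> real vec \<Rightarrow> real \<Rightarrow> bool" where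
  "lp_feasible N x \<rho> \<longleftrightarrow>
     x \<in> carrier_vec (activities N) \<and> Rmat N *\<^sub>v x = alpha N \<and>
     Amat N *\<^sub>v x \<le> \<rho> \<cdot>\<^sub>v ones (servers N) \<and> 0\<^sub>v (activities N) \<le> x"

definition lp_optimal :: "'w network \<Rightarrow> real vec \<Rightarrow> real \<Rightarrow> bool" where
  "lp_optimal N x \<rho> \<longleftrightarrow>
     lp_feasible N x \<rho> \<and> (\<forall>x' \<rho>'. lp_feasible N x' \<rho>' \<longrightarrow> \<rho> \<le> \<rho>')"

definition heavy_traffic :: "'w network \<Rightarrow> bool" where
  "heavy_traffic N \<longleftrightarrow>
     (\<forall>y\<in>{q_lim N, alpha N, sigma_u N, theta1 N}. y \<in> carrier_vec (buffers N) \<and> 0\<^sub>v (buffers N) \<le> y) \<and>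
     (\<forall>y\<in>{beta N, sigma_v N, theta2 N}. y \<in> carrier_vec (activities N) \<and> 0\<^sub>v (activities N) \<le> y) \<and>
     (\<forall>j<activities N. 0 < beta N $ j \<and> 0 < sigma_v N $ j) \<and>
     (\<forall>i<buffers N. (alpha N $ i = 0 \<longleftrightarrow> exo N \<le> i) \<and> (sigma_u N $ i = 0 \<longleftrightarrow> exo N \<le> i)) \<and>
     (\<forall>i<buffers N.
        (\<lambda>n. rseq N n * (alpha_r N (rseq N n) $ i - alpha N $ i)) \<longlonglongrightarrow> theta1 N $ i \<and>
        (\<lambda>n. sigma_u_r N (rseq N n) $ i) \<longlonglongrightarrow> sigma_u N $ i \<and>
        (\<lambda>n. q_r N (rseq N n) $ i / rseq N n) \<longlonglongrightarrow> q_lim N $ i) \<and>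
     (\<forall>j<activities N.
        (\<lambda>n. rseq N n * (beta_r N (rseq N n) $ j - beta N $ j)) \<longlonglongrightarrow> theta2 N $ j \<and>
        (\<lambda>n. sigma_v_r N (rseq N n) $ j) \<longlonglongrightarrow> sigma_v N $ j) \<and>
     lp_optimal N (x_star N) (rho_star N) \<and>
     (\<forall>x \<rho>. lp_optimal N x \<rho> \<longrightarrow> x = x_star N \<and> \<rho> = rho_star N) \<and>
     rho_star N = 1 \<and> Amat N *\<^sub>v x_star N = ones (servers N) \<and>
     basic N \<le> activities N \<and>
     (\<forall>j<basic N. 0 < x_star N $ j) \<and>
     (\<forall>j. basic N \<le> j \<and> j < activities N \<longrightarrow> x_star N $ j = 0)"

text \<open>The block matrix with rows \<open>[B N]\<close> and \<open>[0 -I]\<close>, where \<open>A = [B : N]\<close>.\<close>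

definition Kmat :: "'w network \<Rightarrow> real mat" where
  "Kmat N = (let b = basic N; nb = activities N - basic N in
     four_block_mat
       (mat (servers N) b (\<lambda>(k, j). Amat N $$ (k, j)))
       (mat (servers N) nb (\<lambda>(k, j). Amat N $$ (k, b + j)))
       (0\<^sub>m nb b)
       (- 1\<^sub>m nb))"

subsection \<open>Processes of the \<open>r\<close>-th network under a policy \<open>T\<close>\<close>

definition interarrival :: "'w network \<Rightarrow> real \<Rightarrow> nat \<Rightarrow> nat \<Rightarrow> 'w \<Rightarrow> ereal" where
  "interarrival N r i n \<omega> = (if i < exo N then ereal (arrival_time N r i n \<omega>) else \<infinity>)"

definition xi :: "'w network \<Rightarrow> real \<Rightarrow> nat \<Rightarrow> nat \<Rightarrow> 'w \<Rightarrow> ereal" where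
  "xi N r i m \<omega> = (\<Sum>n=1..m. interarrival N r i n \<omega>)"

definition eta :: "'w network \<Rightarrow> real \<Rightarrow> nat \<Rightarrow> nat \<Rightarrow> 'w \<Rightarrow> real" where
  "eta N r j m \<omega> = (\<Sum>n=1..m. service_time N r j n \<omega>)"

definition Ecount :: "'w network \<Rightarrow> real \<Rightarrow> nat \<Rightarrow> real \<Rightarrow> 'w \<Rightarrow> nat" where
  "Ecount N r i t \<omega> = Max {m. xi N r i m \<omega> \<le> ereal t}"

definition Scount :: "'w network \<Rightarrow> real \<Rightarrow> nat \<Rightarrow> real \<Rightarrow> 'w \<Rightarrow> nat" where
  "Scount N r j t \<omega> = Max {m. eta N r j m \<omega> \<le> t}"

definition Routed :: "'w network \<Rightarrow> real \<Rightarrow> nat \<Rightarrow> nat \<Rightarrow> nat \<Rightarrow> 'w \<Rightarrow> nat" where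
  "Routed N r j i n \<omega> = (\<Sum>m=1..n. routing N r j m (Some i) \<omega>)"

text \<open>A policy is a family \<open>T j t \<omega>\<close> (activity, time, sample point), and likewise for its
  derivative \<open>D j t \<omega>\<close>; only times \<open>t \<ge> 0\<close> matter.\<close>

type_synonym 'w policy = "nat \<Rightarrow> real \<Rightarrow> 'w \<Rightarrow> real"

definition Queue :: "'w network \<Rightarrow> real \<Rightarrow> 'w policy \<Rightarrow> nat \<Rightarrow> real \<Rightarrow> 'w \<Rightarrow> real" where
  "Queue N r T i t \<omega> =
     q_r N r $ i + real (Ecount N r i t \<omega>)
     - (\<Sum>j<activities N. Cmat N $$ (i, j) * real (Scount N r j (T j t \<omega>) \<omega>))
     + (\<Sum>j<activities N. real (Routed N r j i (Scount N r j (T j t \<omega>) \<omega>) \<omega>))"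

definition Idle :: "'w network \<Rightarrow> 'w policy \<Rightarrow> nat \<Rightarrow> real \<Rightarrow> 'w \<Rightarrow> real" where
  "Idle N T k t \<omega> = t - (\<Sum>j<activities N. Amat N $$ (k, j) * T j t \<omega>)"

definition Yproc :: "'w network \<Rightarrow> 'w policy \<Rightarrow> real \<Rightarrow> 'w \<Rightarrow> real vec" where
  "Yproc N T t \<omega> = vec (activities N) (\<lambda>j. x_star N $ j * t - T j t \<omega>)"

definition Uproc :: "'w network \<Rightarrow> 'w policy \<Rightarrow> real \<Rightarrow> 'w \<Rightarrow> real vec" where
  "Uproc N T t \<omega> = Kmat N *\<^sub>v Yproc N T t \<omega>"

definition Uhat :: "'w network \<Rightarrow> real \<Rightarrow> 'w policy \<Rightarrow> real \<Rightarrow> 'w \<Rightarrow> real vec" where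
  "Uhat N r T t \<omega> = (1 / r) \<cdot>\<^sub>v Uproc N T (r\<^sup>2 * t) \<omega>"

subsection \<open>Event times and histories\<close>

text \<open>Arrivals and service completions are the jump times of the counting processes.\<close>

definition event_at :: "'w network \<Rightarrow> real \<Rightarrow> 'w policy \<Rightarrow> 'w \<Rightarrow> real \<Rightarrow> bool" where
  "event_at N r T \<omega> t \<longleftrightarrow>
     (\<exists>i<buffers N. \<forall>s. 0 \<le> s \<and> s < t \<longrightarrow> Ecount N r i s \<omega> < Ecount N r i t \<omega>) \<or>
     (\<exists>j<activities N. \<forall>s. 0 \<le> s \<and> s < t \<longrightarrow>
        Scount N r j (T j s \<omega>) \<omega> < Scount N r j (T j t \<omega>) \<omega>)"

primrec Upsilon :: "'w network \<Rightarrow> real \<Rightarrow> 'w policy \<Rightarrow> 'w \<Rightarrow> nat \<Rightarrow> real" where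
  "Upsilon N r T \<omega> 0 = 0"
| "Upsilon N r T \<omega> (Suc l) = Inf {t. Upsilon N r T \<omega> l < t \<and> event_at N r T \<omega> t}"

type_synonym snapshot =
  "real \<times> (nat \<Rightarrow> ereal) \<times> (nat \<Rightarrow> real) \<times> (nat \<Rightarrow> real) \<times> (nat \<Rightarrow> real)"

definition snapshot :: "'w network \<Rightarrow> real \<Rightarrow> 'w policy \<Rightarrow> 'w policy \<Rightarrow> nat \<Rightarrow> 'w \<Rightarrow> snapshot" where
  "snapshot N r T D l \<omega> = (let \<upsilon> = Upsilon N r T \<omega> l in
     (\<upsilon>,
      (\<lambda>i\<in>{..<buffers N}. xi N r i (Ecount N r i \<upsilon> \<omega> + 1) \<omega> - ereal \<upsilon>),
      (\<lambda>j\<in>{..<activities N}. eta N r j (Scount N r j (T j \<upsilon> \<omega>) \<omega> + 1) \<omega> - T j \<upsilon> \<omega>),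
      (\<lambda>i\<in>{..<buffers N}. if l = 0 then 0 else Queue N r T i \<upsilon> \<omega>),
      (\<lambda>j\<in>{..<activities N}. case l of 0 \<Rightarrow> 0 | Suc l' \<Rightarrow> D j (Upsilon N r T \<omega> l') \<omega>)))"

definition history :: "'w network \<Rightarrow> real \<Rightarrow> 'w policy \<Rightarrow> 'w policy \<Rightarrow> nat \<Rightarrow> 'w \<Rightarrow> nat \<Rightarrow> snapshot" where
  "history N r T D l \<omega> = (\<lambda>l'\<in>{..l}. snapshot N r T D l' \<omega>)"

definition snapshot_space :: "'w network \<Rightarrow> snapshot measure" where
  "snapshot_space N =
     borel \<Otimes>\<^sub>M (\<Pi>\<^sub>M i\<in>{..<buffers N}. borel) \<Otimes>\<^sub>M (\<Pi>\<^sub>M j\<in>{..<activities N}. borel)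
     \<Otimes>\<^sub>M (\<Pi>\<^sub>M i\<in>{..<buffers N}. borel) \<Otimes>\<^sub>M (\<Pi>\<^sub>M j\<in>{..<activities N}. borel)"

definition history_space :: "'w network \<Rightarrow> nat \<Rightarrow> (nat \<Rightarrow> snapshot) measure" where
  "history_space N l = (\<Pi>\<^sub>M l'\<in>{..l}. snapshot_space N)"

subsection \<open>Sample paths\<close>

text \<open>\<open>Max\<close> is unspecified on infinite sets: for the maxima defining \<open>Ecount\<close> and \<open>Scount\<close> to
  exist, the partial sums must eventually exceed every level.  Like positivity, this holds almost
  surely.\<close>

definition regular_path :: "'w network \<Rightarrow> real \<Rightarrow> 'w \<Rightarrow> bool" where
  "regular_path N r \<omega> \<longleftrightarrow>
     (\<forall>i<exo N. (\<forall>n\<ge>1. 0 < arrival_time N r i n \<omega>) \<and> (\<forall>t. finite {m. xi N r i m \<omega> \<le> ereal t})) \<and>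
     (\<forall>j<activities N. (\<forall>n\<ge>1. 0 < service_time N r j n \<omega>) \<and> (\<forall>t. finite {m. eta N r j m \<omega> \<le> t}))"

definition feasible_path :: "'w network \<Rightarrow> real \<Rightarrow> 'w policy \<Rightarrow> 'w \<Rightarrow> bool" where
  "feasible_path N r T \<omega> \<longleftrightarrow>
     (\<forall>j<activities N. mono_on {0..} (\<lambda>t. T j t \<omega>) \<and> (\<forall>t\<ge>0. 0 \<le> T j t \<omega>) \<and> T j 0 \<omega> = 0) \<and>
     (\<forall>k<servers N. mono_on {0..} (\<lambda>t. Idle N T k t \<omega>) \<and> (\<forall>t\<ge>0. 0 \<le> Idle N T k t \<omega>) \<and>
        Idle N T k 0 \<omega> = 0) \<and>
     (\<forall>i<buffers N. \<forall>t\<ge>0. 0 \<le> Queue N r T i t \<omega>)"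

text \<open>\<open>D\<close> is the derivative of \<open>T\<close>, constant between events, and its value at the \<open>l\<close>-th event
  is the function \<open>h l\<close> of the history.\<close>

definition feedback_path ::
  "'w network \<Rightarrow> real \<Rightarrow> 'w policy \<Rightarrow> 'w policy \<Rightarrow> (nat \<Rightarrow> nat \<Rightarrow> (nat \<Rightarrow> snapshot) \<Rightarrow> real) \<Rightarrow> 'w \<Rightarrow> bool" where
  "feedback_path N r T D h \<omega> \<longleftrightarrow>
     (\<forall>j<activities N.
        (\<forall>t\<ge>0. D j t \<omega> \<in> {0, 1}) \<and>
        (\<forall>t\<ge>0. T j t \<omega> = (LBINT s:{0..t}. D j s \<omega>)) \<and>
        (\<forall>l t. Upsilon N r T \<omega> l \<le> t \<and> t < Upsilon N r T \<omega> (Suc l) \<longrightarrow>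
           D j t \<omega> = D j (Upsilon N r T \<omega> l) \<omega>) \<and>
        (\<forall>l. D j (Upsilon N r T \<omega> l) \<omega> = h l j (history N r T D l \<omega>)))"

subsection \<open>The multiparameter filtration\<close>

type_synonym mindex = "(nat \<Rightarrow> nat) \<times> (nat \<Rightarrow> nat)"

definition mindices :: "'w network \<Rightarrow> mindex set" where
  "mindices N = (\<Pi>\<^sub>E i\<in>{..<buffers N}. {1..}) \<times> (\<Pi>\<^sub>E j\<in>{..<activities N}. {1..})"

definition mindex_le :: "'w network \<Rightarrow> mindex \<Rightarrow> mindex \<Rightarrow> bool" where
  "mindex_le N a b \<longleftrightarrow>
     (\<forall>i<buffers N. fst a i \<le> fst b i) \<and> (\<forall>j<activities N. snd a j \<le> snd b j)"

definition generators :: "'w network \<Rightarrow> real \<Rightarrow> mindex \<Rightarrow> 'w set set" where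
  "generators N r a =
     {interarrival N r i n -` S \<inter> \<Omega> N | i n S.
        i < buffers N \<and> 1 \<le> n \<and> n \<le> fst a i \<and> S \<in> sets borel}
     \<union> {service_time N r j n -` S \<inter> \<Omega> N | j n S.
        j < activities N \<and> 1 \<le> n \<and> n \<le> snd a j \<and> S \<in> sets borel}
     \<union> {routing N r j n (Some i) -` S \<inter> \<Omega> N | i j n S.
        i < buffers N \<and> j < activities N \<and> 1 \<le> n \<and> n \<le> snd a j}"

text \<open>\<open>Z = {}\<close> gives the filtration generated by the primitives alone, \<open>Z = null_sets (prob_sp N)\<close>
  its augmentation.  The bare filtration is appropriate when the sample path properties hold at
  every sample point; when they hold only almost surely, the counting processes may behave
  arbitrarily on a null set and \<open>sigma0\<close> need only be a stopping time of the augmented filtration.\<close>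

definition Filt :: "'w network \<Rightarrow> real \<Rightarrow> 'w set set \<Rightarrow> mindex \<Rightarrow> 'w set set" where
  "Filt N r Z a = sigma_sets (\<Omega> N) (generators N r a \<union> Z)"

definition Filt_all :: "'w network \<Rightarrow> real \<Rightarrow> 'w set set \<Rightarrow> 'w set set" where
  "Filt_all N r Z = sigma_sets (\<Omega> N) (\<Union>a\<in>mindices N. Filt N r Z a)"

definition mp_stopping_time :: "'w network \<Rightarrow> real \<Rightarrow> 'w set set \<Rightarrow> ('w \<Rightarrow> mindex) \<Rightarrow> bool" where
  "mp_stopping_time N r Z \<tau> \<longleftrightarrow>
     (\<forall>\<omega>\<in>\<Omega> N. \<tau> \<omega> \<in> mindices N) \<and>
     (\<forall>a\<in>mindices N. {\<omega> \<in> \<Omega> N. mindex_le N (\<tau> \<omega>) a} \<in> Filt N r Z a)"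

definition stopped_sigma :: "'w network \<Rightarrow> real \<Rightarrow> 'w set set \<Rightarrow> ('w \<Rightarrow> mindex) \<Rightarrow> 'w set set" where
  "stopped_sigma N r Z \<tau> =
     {F \<in> Filt_all N r Z.
        \<forall>a\<in>mindices N. F \<inter> {\<omega> \<in> \<Omega> N. mindex_le N (\<tau> \<omega>) a} \<in> Filt N r Z a}"

definition sigma0 :: "'w network \<Rightarrow> real \<Rightarrow> 'w policy \<Rightarrow> real \<Rightarrow> 'w \<Rightarrow> mindex" where
  "sigma0 N r T t \<omega> =
     ((\<lambda>i\<in>{..<buffers N}. Ecount N r i (r\<^sup>2 * t) \<omega> + 1),
      (\<lambda>j\<in>{..<activities N}. Scount N r j (T j (r\<^sup>2 * t) \<omega>) \<omega> + 1))"

definition F1 :: "'w network \<Rightarrow> real \<Rightarrow> 'w set set \<Rightarrow> 'w policy \<Rightarrow> real \<Rightarrow> 'w set set" where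
  "F1 N r Z T t = stopped_sigma N r Z (sigma0 N r T t)"

definition is_filtration :: "'w set \<Rightarrow> (real \<Rightarrow> 'w set set) \<Rightarrow> bool" where
  "is_filtration S G \<longleftrightarrow>
     (\<forall>t\<ge>0. sigma_algebra S (G t)) \<and> (\<forall>s t. 0 \<le> s \<and> s \<le> t \<longrightarrow> G s \<subseteq> G t)"

definition adapted :: "'w set \<Rightarrow> (real \<Rightarrow> 'w set set) \<Rightarrow> nat \<Rightarrow> (real \<Rightarrow> 'w \<Rightarrow> real vec) \<Rightarrow> bool" where
  "adapted S G d X \<longleftrightarrow>
     (\<forall>t\<ge>0. \<forall>k<d. (\<lambda>\<omega>. X t \<omega> $ k) \<in> borel_measurable (sigma S (G t)))"

end

theory Submission
  imports Defs
begin

text \<open>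
  Fix a multi-index \<open>a\<close>.  The path up to the \<open>l\<close>-th event is decided by the
  primitives with index at most \<open>a\<close> as long as all counters stay below \<open>a\<close>: the next event
  is the first of the residual arrival times and of the residual service times of the activities in
  use, and the activities in use are a function of the history.  So, by induction on \<open>l\<close>, the
  event \<open>reach a l\<close> that the counters are below \<open>a\<close> at the \<open>l\<close>-th event time lies in
  \<open>Filt a\<close>, and on it the event time, the allocations and the history are measurable with respect
  to \<open>Filt a\<close>.  Since \<open>T\<close> is affine between events and the event times tend to infinity, cutting
  along the last event before \<open>s\<close> shows that \<open>sigma0 \<le> a\<close> belongs to \<open>Filt a\<close> and that
  \<open>T s\<close> is measurable on it.  The sample points with an irregular path form a null set, which is
  treated separately.
\<close>

section \<open>Sample paths\<close>

text \<open>A maximum over a level set becomes an adjunction between counting and partial sums: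
  monotonicity and finiteness make the level set an initial segment that contains 0 and ends at its
  maximum.\<close>

lemma le_Max_level_iff:
  fixes f :: "nat \<Rightarrow> 'b::linorder"
  assumes "mono f" and "f 0 \<le> x" and fin: "finite {m. f m \<le> x}"
  shows "k \<le> Max {m. f m \<le> x} \<longleftrightarrow> f k \<le> x"
proof
  have "Max {m. f m \<le> x} \<in> {m. f m \<le> x}"
    using assms by (intro Max_in) auto
  then have M: "f (Max {m. f m \<le> x}) \<le> x"
    by simp
  show "f k \<le> x" if "k \<le> Max {m. f m \<le> x}"
    using monoD[OF \<open>mono f\<close> that] M by (rule order_trans)
  show "k \<le> Max {m. f m \<le> x}" if "f k \<le> x"
    using fin that by (intro Max_ge) auto
qed

lemma xi_0 [simp]: "xi N r i 0 \<omega> = 0"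
  by (simp add: xi_def)

lemma eta_0 [simp]: "eta N r j 0 \<omega> = 0"
  by (simp add: eta_def)

lemma xi_Suc: "xi N r i (Suc m) \<omega> = xi N r i m \<omega> + interarrival N r i (Suc m) \<omega>"
  by (simp add: xi_def)

lemma eta_Suc: "eta N r j (Suc m) \<omega> = eta N r j m \<omega> + service_time N r j (Suc m) \<omega>"
  by (simp add: eta_def)

lemma xi_exo:
  "i < exo N \<Longrightarrow> xi N r i m \<omega> = ereal (\<Sum>n=1..m. arrival_time N r i n \<omega>)"
  by (simp add: xi_def interarrival_def)

lemma xi_not_exo: "\<not> i < exo N \<Longrightarrow> xi N r i m \<omega> = (if m = 0 then 0 else \<infinity>)"
  by (induction m) (auto simp: xi_Suc interarrival_def)

lemma mono_xi: "regular_path N r \<omega> \<Longrightarrow> mono (\<lambda>m. xi N r i m \<omega>)"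
  by (cases "i < exo N")
     (auto simp: mono_iff_le_Suc xi_exo xi_not_exo regular_path_def less_imp_le)

lemma mono_eta: "regular_path N r \<omega> \<Longrightarrow> j < activities N \<Longrightarrow> mono (\<lambda>m. eta N r j m \<omega>)"
  by (auto simp: mono_iff_le_Suc eta_Suc regular_path_def less_imp_le)

lemma le_Ecount_iff:
  assumes "regular_path N r \<omega>" and "0 \<le> t"
  shows "k \<le> Ecount N r i t \<omega> \<longleftrightarrow> xi N r i k \<omega> \<le> ereal t"
  unfolding Ecount_def
proof (rule le_Max_level_iff)
  show "mono (\<lambda>m. xi N r i m \<omega>)"
    using assms by (intro mono_xi)
  show "finite {m. xi N r i m \<omega> \<le> ereal t}"
  proof (cases "i < exo N")
    case True
    then show ?thesis using assms by (simp add: regular_path_def)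
  next
    case False
    \<comment> \<open>From index 1 on every partial sum is infinite, so only \<open>m = 0\<close>
      stays below a finite level.\<close>
    then have "{m. xi N r i m \<omega> \<le> ereal t} \<subseteq> {0}"
      by (auto simp: xi_not_exo split: if_splits)
    then show ?thesis by (rule finite_subset) simp
  qed
qed (use assms in auto)

lemma le_Scount_iff:
  assumes "regular_path N r \<omega>" and "j < activities N" and "0 \<le> t"
  shows "k \<le> Scount N r j t \<omega> \<longleftrightarrow> eta N r j k \<omega> \<le> t"
  unfolding Scount_def
  by (rule le_Max_level_iff) (use assms mono_eta[of N r \<omega> j] in \<open>auto simp: regular_path_def\<close>)

text \<open>Collects what is needed of one sample point, so that the path analysis is deterministic.
  \<open>exo_pos\<close> provides a further event after every time; \<open>D_borel\<close> allows
  the integral of \<open>D\<close> to be split at event times.\<close>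

locale good_path =
  fixes N :: "'w network" and r :: real and T D :: "'w policy"
    and h :: "nat \<Rightarrow> nat \<Rightarrow> (nat \<Rightarrow> snapshot) \<Rightarrow> real" and \<omega> :: 'w
  assumes regular: "regular_path N r \<omega>"
    and feasible: "feasible_path N r T \<omega>"
    and feedback: "feedback_path N r T D h \<omega>"
    and exo_pos: "0 < exo N" and exo_le: "exo N \<le> buffers N"
    and D_borel: "\<And>j. j < activities N \<Longrightarrow> (\<lambda>t. D j t \<omega>) \<in> borel_measurable (restrict_space borel {0..})"
begin

abbreviation "\<upsilon> \<equiv> Upsilon N r T \<omega>"
abbreviation "E i t \<equiv> Ecount N r i t \<omega>"
abbreviation "S j t \<equiv> Scount N r j (T j t \<omega>) \<omega>"

lemma T_nonneg: "j < activities N \<Longrightarrow> 0 \<le> t \<Longrightarrow> 0 \<le> T j t \<omega>"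
  using feasible by (simp add: feasible_path_def)

lemma T_mono: "j < activities N \<Longrightarrow> 0 \<le> s \<Longrightarrow> s \<le> t \<Longrightarrow> T j s \<omega> \<le> T j t \<omega>"
  using feasible by (auto simp: feasible_path_def mono_on_def)

lemma T_0: "j < activities N \<Longrightarrow> T j 0 \<omega> = 0"
  using feasible by (simp add: feasible_path_def)

lemma D_cases: "j < activities N \<Longrightarrow> 0 \<le> t \<Longrightarrow> D j t \<omega> = 0 \<or> D j t \<omega> = 1"
  using feedback by (auto simp: feedback_path_def)

lemma le_E: "0 \<le> t \<Longrightarrow> k \<le> E i t \<longleftrightarrow> xi N r i k \<omega> \<le> ereal t"
  by (rule le_Ecount_iff[OF regular])

lemma le_S: "j < activities N \<Longrightarrow> 0 \<le> t \<Longrightarrow> k \<le> S j t \<longleftrightarrow> eta N r j k \<omega> \<le> T j t \<omega>"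
  by (rule le_Scount_iff[OF regular _ T_nonneg])

lemma less_E: "0 \<le> t \<Longrightarrow> E i t < k \<longleftrightarrow> ereal t < xi N r i k \<omega>"
  using le_E[of t k i] by auto

lemma less_S: "j < activities N \<Longrightarrow> 0 \<le> t \<Longrightarrow> S j t < k \<longleftrightarrow> T j t \<omega> < eta N r j k \<omega>"
  using le_S[of j t k] by auto

lemma E_mono: "0 \<le> s \<Longrightarrow> s \<le> t \<Longrightarrow> E i s \<le> E i t"
  using le_E[of s "E i s" i] le_E[of t "E i s" i]
    order_trans[of "xi N r i (E i s) \<omega>" "ereal s" "ereal t"] by simp

lemma S_mono:
  assumes "j < activities N" "0 \<le> s" "s \<le> t"
  shows "S j s \<le> S j t"
  using le_S[of j s "S j s"] le_S[of j t "S j s"] T_mono[OF assms] assms by simp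

section \<open>Events are isolated and tend to infinity\<close>

definition total :: "real \<Rightarrow> nat" where
  "total t = (\<Sum>i<buffers N. E i t) + (\<Sum>j<activities N. S j t)"

lemma total_mono: "0 \<le> s \<Longrightarrow> s \<le> t \<Longrightarrow> total s \<le> total t"
  unfolding total_def by (intro add_mono sum_mono E_mono S_mono) auto

text \<open>All counters are nondecreasing in time, and an event makes at least one of them exceed
  its value at every earlier time.\<close>

lemma total_strict:
  assumes "event_at N r T \<omega> t" and "0 \<le> s" and "s < t"
  shows "total s < total t"
proof -
  have E: "(\<Sum>i<buffers N. E i s) \<le> (\<Sum>i<buffers N. E i t)"
    using assms by (intro sum_mono E_mono) auto
  have S: "(\<Sum>j<activities N. S j s) \<le> (\<Sum>j<activities N. S j t)"
    using assms by (intro sum_mono S_mono) auto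
  from assms consider i where "i < buffers N" "E i s < E i t"
    | j where "j < activities N" "S j s < S j t"
    unfolding event_at_def by blast
  then show ?thesis
  proof cases
    case 1
    have "(\<Sum>i<buffers N. E i s) < (\<Sum>i<buffers N. E i t)"
      using 1 assms by (intro sum_strict_mono_ex1) (auto intro!: E_mono)
    then show ?thesis using S by (simp add: total_def)
  next
    case 2
    have "(\<Sum>j<activities N. S j s) < (\<Sum>j<activities N. S j t)"
      using 2 assms by (intro sum_strict_mono_ex1) (auto intro!: S_mono)
    then show ?thesis using E by (simp add: total_def)
  qed
qed

text \<open>The counter is below \<open>k\<close> before \<open>t\<close> and at least
  \<open>k\<close> at \<open>t\<close>, so it jumps there. Not having reached \<open>k\<close> at
  \<open>c\<close>, it forces \<open>t\<close> to lie after \<open>c\<close>.\<close>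

lemma event_arrival:
  assumes "i < buffers N" and "0 \<le> c" and "xi N r i k \<omega> = ereal t" and "E i c < k"
  shows "event_at N r T \<omega> t" and "c < t"
proof -
  show ct: "c < t"
    using assms less_E[of c i k] by simp
  have "E i s < E i t" if "0 \<le> s" "s < t" for s
    using that assms ct less_E[of s i k] le_E[of t k i] by simp
  then show "event_at N r T \<omega> t"
    using assms unfolding event_at_def by blast
qed

lemma event_exists:
  assumes "0 \<le> c"
  shows "\<exists>t>c. event_at N r T \<omega> t"
  \<comment> \<open>Buffer 0 is exogenous, so its first arrival after \<open>c\<close> happens at a
    finite time.\<close>
  using event_arrival[of 0 c "Suc (E 0 c)"] assms exo_pos exo_le
  by (auto simp: xi_exo)

text \<open>Every event increases \<open>total\<close>, so an event after \<open>c\<close> with the least value of \<open>total\<close> is the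
  first one; this is why the infimum in \<open>Upsilon\<close> is attained.\<close>

lemma next_event:
  assumes "0 \<le> c"
  defines "d \<equiv> Inf {t. c < t \<and> event_at N r T \<omega> t}"
  shows "c < d" and "event_at N r T \<omega> d"
    and "\<And>t. c < t \<Longrightarrow> event_at N r T \<omega> t \<Longrightarrow> d \<le> t"
proof -
  let ?W = "{t. c < t \<and> event_at N r T \<omega> t}"
  obtain e where e: "e \<in> ?W" and least: "\<And>t. t \<in> ?W \<Longrightarrow> total e \<le> total t"
    using event_exists[OF \<open>0 \<le> c\<close>] ex_has_least_nat[of "\<lambda>t. t \<in> ?W" _ total] by blast
  \<comment> \<open>An event \<open>t < e\<close> would have a smaller value of
    \<open>total\<close>, because \<open>e\<close> is itself an event.\<close>
  have min: "e \<le> t" if "t \<in> ?W" for t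
    using least[OF that] total_strict[of e t] e that \<open>0 \<le> c\<close> by force
  have "d = e"
    unfolding d_def using e min by (intro cInf_eq_minimum)
  then show "c < d" "event_at N r T \<omega> d"
    and "\<And>t. c < t \<Longrightarrow> event_at N r T \<omega> t \<Longrightarrow> d \<le> t"
    using e min by auto
qed

lemma Upsilon_nonneg: "0 \<le> \<upsilon> l"
  proof (induction l)
  case (Suc l)
  then show ?case
    using next_event(1)[OF Suc.IH] by simp
qed simp

lemma Upsilon_less_Suc: "\<upsilon> l < \<upsilon> (Suc l)"
  using next_event(1)[OF Upsilon_nonneg] by simp

lemma event_Upsilon_Suc: "event_at N r T \<omega> (\<upsilon> (Suc l))"
  using next_event(2)[OF Upsilon_nonneg] by simp

lemma Upsilon_Suc_le: "\<upsilon> l < t \<Longrightarrow> event_at N r T \<omega> t \<Longrightarrow> \<upsilon> (Suc l) \<le> t"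
  using next_event(3)[OF Upsilon_nonneg] by simp

text \<open>Each event raises a natural number by at least one. As \<open>total s\<close> is finite
  for every \<open>s\<close>, event times cannot accumulate.\<close>

lemma total_Upsilon: "l \<le> total (\<upsilon> l)"
proof (induction l)
  case (Suc l)
  then show ?case
    using total_strict[OF event_Upsilon_Suc Upsilon_nonneg Upsilon_less_Suc, of l] by simp
qed simp

lemma ex_Upsilon_interval:
  assumes "0 \<le> s"
  shows "\<exists>l. \<upsilon> l \<le> s \<and> s < \<upsilon> (Suc l)"
proof -
  \<comment> \<open>Otherwise monotonicity would bound \<open>total\<close> at this event time by
    \<open>total s\<close>, while it is at least \<open>Suc (total s)\<close>.\<close>
  have *: "s < \<upsilon> (Suc (total s))"
    using total_mono[OF Upsilon_nonneg, of "Suc (total s)" s] total_Upsilon[of "Suc (total s)"]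
    by linarith
  \<comment> \<open>The predecessor of the first event after \<open>s\<close> is the last one not
    after \<open>s\<close>; it exists because \<open>\<upsilon> 0 = 0 \<le> s\<close>.\<close>
  define k where "k = (LEAST k. s < \<upsilon> k)"
  have k: "s < \<upsilon> k"
    unfolding k_def using * by (rule LeastI)
  then have "k \<noteq> 0"
    using assms by (cases k) auto
  moreover have "\<not> s < \<upsilon> (k - 1)"
    using not_less_Least[of "k - 1" "\<lambda>k. s < \<upsilon> k"] \<open>k \<noteq> 0\<close> by (simp add: k_def)
  ultimately show ?thesis
    using k by (intro exI[of _ "k - 1"]) auto
qed

text \<open>Interval integrals ignore endpoints, so constancy of \<open>D\<close> on the half-open
  interval between two events gives linear growth up to and including the next event, where
  \<open>D\<close> may jump.\<close>

lemma T_affine: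
  assumes j: "j < activities N" and t: "\<upsilon> l \<le> t" "t \<le> \<upsilon> (Suc l)"
  shows "T j t \<omega> = T j (\<upsilon> l) \<omega> + D j (\<upsilon> l) \<omega> * (t - \<upsilon> l)"
proof -
  have T: "T j s \<omega> = (LBINT x=0..s. D j x \<omega>)" if "0 \<le> s" for s
    using feedback j that interval_integral_Icc[OF that, of "\<lambda>x. D j x \<omega>"]
    by (simp add: feedback_path_def zero_ereal_def)
  \<comment> \<open>\<open>D\<close> is controlled on nonnegative times. There it is measurable and
    at most 1, hence integrable on the open interval over which the interval integral is
    taken.\<close>
  have "set_borel_measurable borel {0..} (\<lambda>x. D j x \<omega>)"
    using D_borel[OF j] by (simp add: set_borel_measurable_def borel_measurable_restrict_space_iff)
  then have "set_borel_measurable borel {0<..<t} (\<lambda>x. D j x \<omega>)"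
    by (rule set_borel_measurable_subset) auto
  then have meas: "set_borel_measurable lborel {0<..<t} (\<lambda>x. D j x \<omega>)"
    by (simp add: set_borel_measurable_def)
  have "norm (D j x \<omega>) \<le> norm (1::real)" if "x \<in> {0<..<t}" for x
    using D_cases[OF j, of x] that by auto
  then have bound: "AE x in lborel. x \<in> {0<..<t} \<longrightarrow> norm (D j x \<omega>) \<le> norm (1::real)"
    by simp
  have "integrable lborel (indicat_real {0<..<t})"
    using Upsilon_nonneg[of l] t by (intro integrable_real_indicator) auto
  then have "set_integrable lborel {0<..<t} (\<lambda>_. 1::real)"
    by (simp add: set_integrable_def)
  then have "set_integrable lborel {0<..<t} (\<lambda>x. D j x \<omega>)"
    by (rule set_integrable_bound[OF _ meas bound])
  then have "interval_lebesgue_integrable lborel 0 t (\<lambda>x. D j x \<omega>)"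
    using Upsilon_nonneg[of l] t by (simp add: interval_lebesgue_integrable_def zero_ereal_def)
  then have "(LBINT x=0..\<upsilon> l. D j x \<omega>) + (LBINT x=\<upsilon> l..t. D j x \<omega>) = (LBINT x=0..t. D j x \<omega>)"
    using Upsilon_nonneg[of l] t
    by (intro interval_integral_sum) (auto simp: min_def max_def zero_ereal_def)
  moreover have "(LBINT x=\<upsilon> l..t. D j x \<omega>) = (LBINT x=\<upsilon> l..t. D j (\<upsilon> l) \<omega>)"
    using feedback j t
    by (intro interval_integral_cong) (auto simp: feedback_path_def einterval_iff min_def max_def)
  ultimately show ?thesis
    using T[of t] T[OF Upsilon_nonneg, of l] Upsilon_nonneg[of l] t by simp
qed

lemma T_Upsilon_Suc:
  "j < activities N \<Longrightarrow>
    T j (\<upsilon> (Suc l)) \<omega> = T j (\<upsilon> l) \<omega> + D j (\<upsilon> l) \<omega> * (\<upsilon> (Suc l) - \<upsilon> l)"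
  by (rule T_affine) (use Upsilon_less_Suc in \<open>auto intro: less_imp_le\<close>)

text \<open>The next event time is the minimum of the next arrival times and of the completion times
  of the active services. Stating this through lower bounds avoids a minimum with infinite entries
  and matches the sets tested for measurability later.\<close>

lemma le_Upsilon_Suc_iff:
  "b \<le> \<upsilon> (Suc l) \<longleftrightarrow>
     (\<forall>i<buffers N. ereal b \<le> xi N r i (E i (\<upsilon> l) + 1) \<omega>) \<and>
     (\<forall>j<activities N. D j (\<upsilon> l) \<omega> = 1 \<longrightarrow>
        b \<le> \<upsilon> l + (eta N r j (S j (\<upsilon> l) + 1) \<omega> - T j (\<upsilon> l) \<omega>))"
proof -
  let ?d = "\<upsilon> (Suc l)"
  let ?z = "\<lambda>j. \<upsilon> l + (eta N r j (S j (\<upsilon> l) + 1) \<omega> - T j (\<upsilon> l) \<omega>)"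
  have arrivals: "ereal ?d \<le> xi N r i (E i (\<upsilon> l) + 1) \<omega>" if i: "i < buffers N" for i
  proof (cases "i < exo N")
    case True
    then obtain w where w: "xi N r i (E i (\<upsilon> l) + 1) \<omega> = ereal w"
      by (simp add: xi_exo)
    then have "event_at N r T \<omega> w" "\<upsilon> l < w"
      using event_arrival[OF i Upsilon_nonneg w] by auto
    then show ?thesis using Upsilon_Suc_le w by simp
  qed (simp add: xi_not_exo)
  \<comment> \<open>Up to \<open>?d\<close> the allocation \<open>T\<close> is affine with slope 1,
    so a value \<open>?z j\<close> before \<open>?d\<close> would be the time at which
    \<open>T\<close> hits the next completion level, that is, an event between two consecutive
    events.\<close>
  have services: "?d \<le> ?z j" if j: "j < activities N" and D1: "D j (\<upsilon> l) \<omega> = 1" for j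
  proof (rule ccontr)
    assume less: "\<not> ?d \<le> ?z j"
    have gt: "\<upsilon> l < ?z j"
      using less_S[OF j Upsilon_nonneg, of l "S j (\<upsilon> l) + 1"] by simp
    have Tz: "T j (?z j) \<omega> = eta N r j (S j (\<upsilon> l) + 1) \<omega>"
      using T_affine[OF j, of l "?z j"] less gt D1 by simp
    have "S j s < S j (?z j)" if "0 \<le> s" "s < ?z j" for s
    proof -
      have "T j s \<omega> < eta N r j (S j (\<upsilon> l) + 1) \<omega>"
      proof (cases "s \<le> \<upsilon> l")
        case True
        then show ?thesis
          using T_mono[OF j that(1) True] gt by linarith
      next
        case False
        then show ?thesis
          using T_affine[OF j, of l s] that less D1 by simp
      qed
      then have "S j s < S j (\<upsilon> l) + 1"
        using less_S[OF j that(1)] by simp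
      also have "S j (\<upsilon> l) + 1 \<le> S j (?z j)"
        using le_S[OF j, of "?z j"] Tz that by simp
      finally show ?thesis .
    qed
    then have "event_at N r T \<omega> (?z j)"
      using j unfolding event_at_def by blast
    then show False
      using Upsilon_Suc_le[OF gt] less by simp
  qed
  \<comment> \<open>Conversely the minimum is attained: \<open>?d\<close> is an event, so some
    counter has grown since \<open>\<upsilon> l\<close>.\<close>
  have "(\<exists>i<buffers N. xi N r i (E i (\<upsilon> l) + 1) \<omega> \<le> ereal ?d) \<or>
        (\<exists>j<activities N. D j (\<upsilon> l) \<omega> = 1 \<and> ?z j \<le> ?d)"
  proof -
    from event_Upsilon_Suc[of l] Upsilon_nonneg[of l] Upsilon_less_Suc[of l]
    consider i where "i < buffers N" "E i (\<upsilon> l) < E i ?d"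
      | j where "j < activities N" "S j (\<upsilon> l) < S j ?d"
      unfolding event_at_def by blast
    then show ?thesis
    proof cases
      case 1
      then show ?thesis
        using le_E[OF Upsilon_nonneg, of "E i (\<upsilon> l) + 1" i "Suc l"] by auto
    next
      case 2
      then have "eta N r j (S j (\<upsilon> l) + 1) \<omega> \<le> T j ?d \<omega>"
        using le_S[OF 2(1) Upsilon_nonneg, of "S j (\<upsilon> l) + 1" "Suc l"] by simp
      moreover have "T j (\<upsilon> l) \<omega> < eta N r j (S j (\<upsilon> l) + 1) \<omega>"
        using less_S[OF 2(1) Upsilon_nonneg, of l "S j (\<upsilon> l) + 1"] by simp
      \<comment> \<open>\<open>T\<close> rises from below the completion level to at least that
        level, so the slope is not 0 and hence is 1.\<close>
      ultimately have "D j (\<upsilon> l) \<omega> = 1 \<and> ?z j \<le> ?d"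
        using T_Upsilon_Suc[OF 2(1), of l] D_cases[OF 2(1) Upsilon_nonneg, of l] by auto
      then show ?thesis using 2(1) by blast
    qed
  qed
  note attained = this
  show ?thesis
  proof
    assume b: "b \<le> ?d"
    then show "(\<forall>i<buffers N. ereal b \<le> xi N r i (E i (\<upsilon> l) + 1) \<omega>) \<and>
        (\<forall>j<activities N. D j (\<upsilon> l) \<omega> = 1 \<longrightarrow> b \<le> ?z j)"
      using order_trans[OF b services] order_trans[OF _ arrivals, of "ereal b"]
      by (simp only: ereal_less_eq) blast
  next
    assume b: "(\<forall>i<buffers N. ereal b \<le> xi N r i (E i (\<upsilon> l) + 1) \<omega>) \<and>
        (\<forall>j<activities N. D j (\<upsilon> l) \<omega> = 1 \<longrightarrow> b \<le> ?z j)"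
    from attained show "b \<le> ?d"
    proof (elim disjE exE conjE)
      fix i assume "i < buffers N" and "xi N r i (E i (\<upsilon> l) + 1) \<omega> \<le> ereal ?d"
      then have "ereal b \<le> ereal ?d"
        using b order_trans by blast
      then show ?thesis by simp
    next
      fix j assume "j < activities N" and "D j (\<upsilon> l) \<omega> = 1" and "?z j \<le> ?d"
      then show ?thesis
        using b order_trans[of b "?z j" ?d] by blast
    qed
  qed
qed

lemma D_Upsilon: "j < activities N \<Longrightarrow> D j (\<upsilon> l) \<omega> = h l j (history N r T D l \<omega>)"
  using feedback by (simp add: feedback_path_def)

end

section \<open>Almost sure regularity\<close>

text \<open>A positive variable exceeds some \<open>e > 0\<close> with positive probability. By the
  Borel zero-one law infinitely many terms of the sequence exceed \<open>e\<close> almost surely, so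
  the partial sums outgrow every level.\<close>

lemma (in prob_space) AE_iid_pos_finite_level:
  fixes X :: "nat \<Rightarrow> 'a \<Rightarrow> real"
  assumes iid: "iid M borel X" and pos: "\<And>n. 1 \<le> n \<Longrightarrow> AE \<omega> in M. 0 < X n \<omega>"
  shows "AE \<omega> in M. \<forall>t. finite {m. (\<Sum>n=1..m. X n \<omega>) \<le> t}"
proof -
  have indep: "indep_vars (\<lambda>_. borel) X {1..}"
    and dist: "\<And>n. 1 \<le> n \<Longrightarrow> distr M borel (X n) = distr M borel (X 1)"
    using iid unfolding iid_def by blast+
  have [measurable]: "X (Suc n) \<in> borel_measurable M" for n
    using indep by (auto simp: indep_vars_def2)
  obtain e where e: "0 < e" and p: "prob {\<omega>\<in>space M. e < X (Suc 0) \<omega>} \<noteq> 0"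
  proof -
    \<comment> \<open>Otherwise the countably many bounds \<open>1 / real (Suc k)\<close> would make
      \<open>X (Suc 0)\<close> nonpositive almost surely.\<close>
    have False if all: "\<And>e. 0 < e \<Longrightarrow> prob {\<omega>\<in>space M. e < X (Suc 0) \<omega>} = 0"
    proof -
      have "AE \<omega> in M. \<not> 1 / real (Suc k) < X (Suc 0) \<omega>" for k
        using all[of "1 / real (Suc k)"]
        by (subst prob_Collect_eq_0[symmetric]) auto
      then have "AE \<omega> in M. \<forall>k. \<not> 1 / real (Suc k) < X (Suc 0) \<omega>"
        by (simp add: AE_all_countable)
      moreover have "AE \<omega> in M. 0 < X (Suc 0) \<omega>"
        using pos[of 1] by simp
      ultimately have "AE \<omega> in M. False"
        by eventually_elim (metis nat_approx_posE)
      then show False by simp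
    qed
    then show ?thesis using that by blast
  qed
  have prob_eq: "prob {\<omega>\<in>space M. e < X (Suc n) \<omega>} = prob {\<omega>\<in>space M. e < X (Suc 0) \<omega>}" for n
  proof -
    have "prob {\<omega>\<in>space M. e < X (Suc n) \<omega>} = measure (distr M borel (X (Suc n))) {e<..}" for n
      by (subst measure_distr) (auto simp: vimage_def Int_def conj_commute)
    then show ?thesis using dist[of "Suc n"] by simp
  qed
  have "indep_events (\<lambda>n. {\<omega>\<in>space M. e < X n \<omega>}) {1..}"
    by (rule indep_eventsI_indep_vars[OF indep]) auto
  then have prod: "prob (\<Inter>n\<in>J. {\<omega>\<in>space M. e < X n \<omega>}) = (\<Prod>n\<in>J. prob {\<omega>\<in>space M. e < X n \<omega>})"
    if "J \<subseteq> {1..}" "finite J" "J \<noteq> {}" for J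
    using that unfolding indep_events_def by blast
  \<comment> \<open>Samples start at index 1, whereas the zero-one law is applied to a sequence
    indexed by all naturals.\<close>
  have "indep_events (\<lambda>m. {\<omega>\<in>space M. e < X (Suc m) \<omega>}) UNIV"
  proof (rule indep_eventsI)
    fix J :: "nat set" assume "finite J" "J \<noteq> {}"
    then show "prob (\<Inter>m\<in>J. {\<omega>\<in>space M. e < X (Suc m) \<omega>}) = (\<Prod>m\<in>J. prob {\<omega>\<in>space M. e < X (Suc m) \<omega>})"
      using prod[of "Suc ` J"] by (simp add: prod.reindex image_subset_iff)
  qed simp
  then have "(AE \<omega> in M. infinite {m. e < X (Suc m) \<omega>}) \<or> (AE \<omega> in M. finite {m. e < X (Suc m) \<omega>})"
    by (rule borel_0_1_law_AE)
  \<comment> \<open>If only finitely many terms exceeded \<open>e\<close>, the indicators would tend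
    to 0 and, by dominated convergence, so would their expectations. But these all equal one nonzero
    probability.\<close>
  moreover have "\<not> (AE \<omega> in M. finite {m. e < X (Suc m) \<omega>})"
  proof
    assume fin: "AE \<omega> in M. finite {m. e < X (Suc m) \<omega>}"
    let ?F = "\<lambda>m. {\<omega>\<in>space M. e < X (Suc m) \<omega>}"
    have "(\<lambda>m. LINT \<omega>|M. indicat_real (?F m) \<omega>) \<longlonglongrightarrow> (LINT \<omega>|M. 0)"
    proof (rule integral_dominated_convergence[where w = "\<lambda>_. 1"])
      show "AE \<omega> in M. (\<lambda>m. indicat_real (?F m) \<omega>) \<longlonglongrightarrow> 0"
        using fin
      proof eventually_elim
        case (elim \<omega>)
        then have "eventually (\<lambda>m. \<not> e < X (Suc m) \<omega>) sequentially"
          by (simp add: eventually_cofinite flip: cofinite_eq_sequentially)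
        then have "eventually (\<lambda>m. indicat_real (?F m) \<omega> = 0) sequentially"
          by eventually_elim simp
        then show ?case by (rule tendsto_eventually)
      qed
    qed (simp_all add: indicator_def)
    moreover have "(LINT \<omega>|M. indicat_real (?F m) \<omega>) = prob {\<omega>\<in>space M. e < X (Suc 0) \<omega>}" for m
      using prob_eq[of m] by simp
    ultimately have "(\<lambda>m::nat. prob {\<omega>\<in>space M. e < X (Suc 0) \<omega>}) \<longlonglongrightarrow> 0"
      by (simp only: Bochner_Integration.integral_zero)
    then show False using p by (simp add: LIMSEQ_const_iff)
  qed
  ultimately have inf: "AE \<omega> in M. infinite {m. e < X (Suc m) \<omega>}"
    by blast
  have "AE \<omega> in M. 0 < X (Suc n) \<omega>" for n
    using pos by simp
  then have "AE \<omega> in M. \<forall>n. 0 < X (Suc n) \<omega>"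
    by (simp add: AE_all_countable)
  with inf show ?thesis
  proof eventually_elim
    case (elim \<omega>)
    show ?case
    proof (intro allI)
      fix t
      \<comment> \<open>Any \<open>k\<close> terms above \<open>e\<close> sum to more than
        \<open>t\<close>; positivity of the others keeps every longer partial sum above
        \<open>t\<close>.\<close>
      obtain k :: nat where k: "t < real k * e"
        using reals_Archimedean3[OF e] by blast
      obtain B where B: "B \<subseteq> {m. e < X (Suc m) \<omega>}" "finite B" "card B = k"
        using infinite_arbitrarily_large[OF elim(1)] by blast
      then obtain b where b: "B \<subseteq> {..<b}"
        using finite_nat_iff_bounded by blast
      have "t < (\<Sum>n=1..m. X n \<omega>)" if "b \<le> m" for m
      proof -
        have "t < (\<Sum>n\<in>B. e)"
          using B k by simp
        also have "\<dots> \<le> (\<Sum>n\<in>B. X (Suc n) \<omega>)"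
          using B by (intro sum_mono) auto
        also have "\<dots> \<le> (\<Sum>n<m. X (Suc n) \<omega>)"
          using b that elim(2) by (intro sum_mono2) (auto intro: less_imp_le)
        also have "\<dots> = (\<Sum>n=1..m. X n \<omega>)"
          by (simp add: sum.atLeast1_atMost_eq)
        finally show ?thesis .
      qed
      then have "{m. (\<Sum>n=1..m. X n \<omega>) \<le> t} \<subseteq> {..<b}"
        by (auto simp: not_le[symmetric])
      then show "finite {m. (\<Sum>n=1..m. X n \<omega>) \<le> t}"
        by (rule finite_subset) simp
    qed
  qed
qed

lemma AE_regular_path:
  assumes "network_primitives N" and "r \<in> range (rseq N)"
  shows "AE \<omega> in prob_sp N. regular_path N r \<omega>"
proof -
  interpret prob_space "prob_sp N"
    using assms by (simp add: network_primitives_def)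
  have prim: "arrival_primitives N r" "service_primitives N r"
    using assms by (auto simp: network_primitives_def)
  have "AE \<omega> in prob_sp N. (\<forall>n\<ge>1. 0 < arrival_time N r i n \<omega>) \<and>
      (\<forall>t. finite {m. xi N r i m \<omega> \<le> ereal t})" if "i < exo N" for i
  proof (intro AE_conjI)
    have pos: "AE \<omega> in prob_sp N. 0 < arrival_time N r i n \<omega>" if "1 \<le> n" for n
      using prim \<open>i < exo N\<close> that by (simp add: arrival_primitives_def)
    then show "AE \<omega> in prob_sp N. \<forall>n\<ge>1. 0 < arrival_time N r i n \<omega>"
      unfolding AE_all_countable by auto
    have "AE \<omega> in prob_sp N. \<forall>t. finite {m. (\<Sum>n=1..m. arrival_time N r i n \<omega>) \<le> t}"
      using prim that pos by (intro AE_iid_pos_finite_level) (auto simp: arrival_primitives_def)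
    then show "AE \<omega> in prob_sp N. \<forall>t. finite {m. xi N r i m \<omega> \<le> ereal t}"
      using that by (simp add: xi_exo)
  qed
  moreover have "AE \<omega> in prob_sp N. (\<forall>n\<ge>1. 0 < service_time N r j n \<omega>) \<and>
      (\<forall>t. finite {m. eta N r j m \<omega> \<le> t})" if "j < activities N" for j
  proof (intro AE_conjI)
    have pos: "AE \<omega> in prob_sp N. 0 < service_time N r j n \<omega>" if "1 \<le> n" for n
      using prim \<open>j < activities N\<close> that by (simp add: service_primitives_def)
    then show "AE \<omega> in prob_sp N. \<forall>n\<ge>1. 0 < service_time N r j n \<omega>"
      unfolding AE_all_countable by auto
    show "AE \<omega> in prob_sp N. \<forall>t. finite {m. eta N r j m \<omega> \<le> t}"
      using prim that pos unfolding eta_def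
      by (intro AE_iid_pos_finite_level) (auto simp: service_primitives_def)
  qed
  ultimately show ?thesis
    unfolding regular_path_def
    by (intro AE_conjI) (simp_all add: AE_all_countable)
qed

text \<open>Without exogenous arrivals \<open>alpha\<close> vanishes, so \<open>x = 0\<close> and
  \<open>\<rho> = 0\<close> are feasible, against the optimal value 1.\<close>

lemma exo_pos:
  assumes "network_structure N" and "heavy_traffic N"
  shows "0 < exo N"
proof (rule ccontr)
  assume "\<not> 0 < exo N"
  then have alpha: "alpha N = 0\<^sub>v (buffers N)"
    using assms by (intro eq_vecI) (auto simp: heavy_traffic_def)
  have C: "Cmat N \<in> carrier_mat (buffers N) (activities N)"
    and A: "Amat N \<in> carrier_mat (servers N) (activities N)"
    using assms by (auto simp: network_structure_def)
  have "Rmat N \<in> carrier_mat (buffers N) (activities N)"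
    using C by (auto simp: Rmat_def routing_mat_def mat_diag_def intro!: mult_carrier_mat minus_carrier_mat)
  then have "Rmat N *\<^sub>v 0\<^sub>v (activities N) = alpha N"
    by (auto simp: alpha intro!: eq_vecI)
  moreover have "Amat N *\<^sub>v 0\<^sub>v (activities N) \<le> 0 \<cdot>\<^sub>v ones (servers N)"
    using A by (auto simp: less_eq_vec_def)
  ultimately have "lp_feasible N (0\<^sub>v (activities N)) 0"
    by (simp add: lp_feasible_def)
  moreover have "lp_optimal N (x_star N) 1"
    using assms(2) unfolding heavy_traffic_def by metis
  ultimately have "(1::real) \<le> 0"
    unfolding lp_optimal_def by blast
  then show False by simp
qed

section \<open>Measurability up to an event time\<close>

text \<open>The event \<open>c = k\<close> says that \<open>x\<close> is at least \<open>f k\<close>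
  but less than \<open>f (Suc k)\<close>. As \<open>c < m\<close>, indices up to \<open>m\<close>
  suffice: a counter known to stay below \<open>m\<close> is decided by the first \<open>m\<close>
  partial sums.\<close>

lemma measurable_level_count:
  fixes f :: "nat \<Rightarrow> 'a \<Rightarrow> 'b::{second_countable_topology, linorder_topology}"
  assumes f: "\<And>k. k \<le> m \<Longrightarrow> f k \<in> borel_measurable R" and x: "x \<in> borel_measurable R"
    and c: "\<And>\<omega>. \<omega> \<in> space R \<Longrightarrow> c \<omega> < m"
    and le: "\<And>\<omega> k. \<omega> \<in> space R \<Longrightarrow> k \<le> c \<omega> \<longleftrightarrow> f k \<omega> \<le> x \<omega>"
  shows "c \<in> measurable R (count_space {..<m})"
proof -
  have "c -` {k} \<inter> space R \<in> sets R" if "k < m" for k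
  proof -
    have "c -` {k} \<inter> space R = {\<omega>\<in>space R. f k \<omega> \<le> x \<omega>} - {\<omega>\<in>space R. f (Suc k) \<omega> \<le> x \<omega>}"
      by (auto simp: le[symmetric])
    also have "\<dots> \<in> sets R"
      using f[of k] f[of "Suc k"] x that by (intro sets.Diff borel_measurable_le) auto
    finally show ?thesis .
  qed
  then show ?thesis
    using c by (auto simp: measurable_count_space_eq2)
qed

text \<open>The strict inequalities absorb the \<open>+ 1\<close> in \<open>sigma0\<close>, and they
  leave the next arrival and the next completion among the primitives of index at most
  \<open>a\<close>.\<close>

definition below :: "'w network \<Rightarrow> real \<Rightarrow> 'w policy \<Rightarrow> mindex \<Rightarrow> real \<Rightarrow> 'w \<Rightarrow> bool" where
  "below N r T a s \<omega> \<longleftrightarrow>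
     (\<forall>i<buffers N. Ecount N r i s \<omega> < fst a i) \<and>
     (\<forall>j<activities N. Scount N r j (T j s \<omega>) \<omega> < snd a j)"

lemma mindex_le_sigma0: "mindex_le N (sigma0 N r T t \<omega>) a \<longleftrightarrow> below N r T a (r\<^sup>2 * t) \<omega>"
  by (auto simp: mindex_le_def sigma0_def below_def)

lemma sigma0_mindices: "sigma0 N r T t \<omega> \<in> mindices N"
  by (auto simp: sigma0_def mindices_def)

context good_path
begin

lemma below_antimono: "below N r T a t \<omega> \<Longrightarrow> 0 \<le> s \<Longrightarrow> s \<le> t \<Longrightarrow> below N r T a s \<omega>"
  unfolding below_def by (meson E_mono S_mono le_less_trans)

text \<open>Trades the counters for partial sums of index exactly \<open>a\<close>, which are built
  from the generators at \<open>a\<close>.\<close>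

lemma below_iff:
  "0 \<le> s \<Longrightarrow> below N r T a s \<omega> \<longleftrightarrow>
     (\<forall>i<buffers N. ereal s < xi N r i (fst a i) \<omega>) \<and>
     (\<forall>j<activities N. T j s \<omega> < eta N r j (snd a j) \<omega>)"
  by (simp add: below_def less_E less_S cong: conj_cong)

end

text \<open>\<open>\<Omega>\<^sub>0\<close> is the set of sample points with a good path.  Its complement is a null set if \<open>Z\<close>
  consists of the null sets, and empty if \<open>Z = {}\<close>; assumption \<open>bad\<close> covers both cases.\<close>

locale controlled_network =
  fixes N :: "'w network" and r :: real and T D :: "'w policy"
    and h :: "nat \<Rightarrow> nat \<Rightarrow> (nat \<Rightarrow> snapshot) \<Rightarrow> real"
    and Z :: "'w set set" and \<Omega>\<^sub>0 :: "'w set"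
  assumes arrival_measurable:
      "\<And>i n. i < exo N \<Longrightarrow> 1 \<le> n \<Longrightarrow> arrival_time N r i n \<in> borel_measurable (prob_sp N)"
    and service_measurable:
      "\<And>j n. j < activities N \<Longrightarrow> 1 \<le> n \<Longrightarrow> service_time N r j n \<in> borel_measurable (prob_sp N)"
    and routing_measurable:
      "\<And>i j n. i < buffers N \<Longrightarrow> j < activities N \<Longrightarrow> 1 \<le> n \<Longrightarrow>
        routing N r j n (Some i) \<in> measurable (prob_sp N) (count_space UNIV)"
    and T_measurable: "\<And>j t. j < activities N \<Longrightarrow> 0 \<le> t \<Longrightarrow> T j t \<in> borel_measurable (prob_sp N)"
    and h_measurable: "\<And>l j. j < activities N \<Longrightarrow> h l j \<in> borel_measurable (history_space N l)"
    and Z_sets: "Z \<subseteq> sets (prob_sp N)"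
    and good_sets: "\<Omega>\<^sub>0 \<in> sets (prob_sp N)"
    and bad: "\<And>A. A \<in> sets (prob_sp N) \<Longrightarrow> A \<inter> \<Omega>\<^sub>0 = {} \<Longrightarrow> A \<in> sigma_sets (\<Omega> N) Z"
    and good: "\<And>\<omega>. \<omega> \<in> \<Omega>\<^sub>0 \<Longrightarrow> good_path N r T D h \<omega>"
begin

lemma good_subset: "\<Omega>\<^sub>0 \<subseteq> \<Omega> N"
  using good_sets by (rule sets.sets_into_space)

abbreviation F :: "mindex \<Rightarrow> 'w measure" where
  "F a \<equiv> sigma (\<Omega> N) (generators N r a \<union> Z)"

lemma interarrival_measurable:
  "1 \<le> n \<Longrightarrow> interarrival N r i n \<in> borel_measurable (prob_sp N)"
  unfolding interarrival_def using arrival_measurable[of i n]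
  by (cases "i < exo N") auto

lemma generators_sets: "generators N r a \<union> Z \<subseteq> sets (prob_sp N)"
proof -
  have "routing N r j n (Some i) -` S \<inter> \<Omega> N \<in> sets (prob_sp N)"
    if "i < buffers N" "j < activities N" "1 \<le> n" for i j n S
    using routing_measurable[OF that] by (rule measurable_sets) simp
  then show ?thesis
    using Z_sets measurable_sets[OF interarrival_measurable] measurable_sets[OF service_measurable]
    unfolding generators_def by blast
qed

lemma generators_Pow: "generators N r a \<union> Z \<subseteq> Pow (\<Omega> N)"
  using generators_sets[of a] sets.sets_into_space by blast

lemma space_F [simp]: "space (F a) = \<Omega> N"
  using generators_Pow by (rule space_measure_of)

lemma sets_F: "sets (F a) = Filt N r Z a"
  unfolding Filt_def using generators_Pow by (rule sets_measure_of)

lemma F_subset: "sets (F a) \<subseteq> sets (prob_sp N)"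
  unfolding sets_F Filt_def using generators_sets by (rule sets.sigma_sets_subset)

lemma bad_F: "A \<in> sets (prob_sp N) \<Longrightarrow> A \<inter> \<Omega>\<^sub>0 = {} \<Longrightarrow> A \<in> sets (F a)"
  unfolding sets_F Filt_def using bad sigma_sets_mono'[of Z "generators N r a \<union> Z" "\<Omega> N"] by blast

text \<open>The complement is measurable and misses \<open>\<Omega>\<^sub>0\<close>, so it belongs
  to every \<open>F a\<close>.\<close>

lemma good_F: "\<Omega>\<^sub>0 \<in> sets (F a)"
proof -
  have "\<Omega> N - \<Omega>\<^sub>0 \<in> sets (F a)"
    using good_sets by (intro bad_F) auto
  then have "space (F a) - (\<Omega> N - \<Omega>\<^sub>0) \<in> sets (F a)"
    by (rule sets.compl_sets)
  then show ?thesis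
    using good_subset by (simp add: double_diff)
qed

lemma generator_F: "A \<in> generators N r a \<Longrightarrow> A \<in> sets (F a)"
  unfolding sets_F Filt_def by (rule sigma_sets.Basic) simp

lemma xi_F:
  assumes "i < buffers N" and "k \<le> fst a i"
  shows "xi N r i k \<in> borel_measurable (F a)"
proof -
  have "interarrival N r i n \<in> borel_measurable (F a)" if "1 \<le> n" "n \<le> k" for n
  proof (rule measurableI)
    fix S :: "ereal set" assume "S \<in> sets borel"
    moreover have "n \<le> fst a i"
      using assms that by simp
    ultimately have "interarrival N r i n -` S \<inter> \<Omega> N \<in> generators N r a"
      unfolding generators_def using assms that
      by (intro UnI1 CollectI exI[of _ i] exI[of _ n] exI[of _ S] conjI refl)
    then show "interarrival N r i n -` S \<inter> space (F a) \<in> sets (F a)"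
      using generator_F by simp
  qed simp
  then show ?thesis
    unfolding xi_def[abs_def] by (intro borel_measurable_ereal_sum) auto
qed

lemma eta_F:
  assumes "j < activities N" and "k \<le> snd a j"
  shows "eta N r j k \<in> borel_measurable (F a)"
proof -
  have "service_time N r j n \<in> borel_measurable (F a)" if "1 \<le> n" "n \<le> k" for n
  proof (rule measurableI)
    fix S :: "real set" assume "S \<in> sets borel"
    moreover have "n \<le> snd a j"
      using assms that by simp
    ultimately have "service_time N r j n -` S \<inter> \<Omega> N \<in> generators N r a"
      unfolding generators_def using assms that
      by (intro UnI1[OF UnI2] CollectI exI[of _ j] exI[of _ n] exI[of _ S] conjI refl)
    then show "service_time N r j n -` S \<inter> space (F a) \<in> sets (F a)"
      using generator_F by simp
  qed simp
  then show ?thesis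
    unfolding eta_def[abs_def] by (intro borel_measurable_sum) auto
qed

lemma Routed_F:
  assumes "i < buffers N" "j < activities N" and "k \<le> snd a j"
  shows "(\<lambda>\<omega>. real (Routed N r j i k \<omega>)) \<in> borel_measurable (F a)"
proof -
  have routing: "routing N r j n (Some i) \<in> measurable (F a) (count_space UNIV)" if "1 \<le> n" "n \<le> k" for n
  proof (rule measurableI)
    fix S :: "nat set"
    have "n \<le> snd a j"
      using assms that by simp
    then have "routing N r j n (Some i) -` S \<inter> \<Omega> N \<in> generators N r a"
      unfolding generators_def using assms that
      by (intro UnI2 CollectI exI[of _ i] exI[of _ j] exI[of _ n] exI[of _ S] conjI refl)
    then show "routing N r j n (Some i) -` S \<inter> space (F a) \<in> sets (F a)"
      using generator_F by simp
  qed simp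
  have "(\<lambda>\<omega>. real (routing N r j n (Some i) \<omega>)) \<in> borel_measurable (F a)"
    if "1 \<le> n" "n \<le> k" for n
    by (rule measurable_compose[OF routing[OF that]]) simp
  then show ?thesis
    unfolding Routed_def of_nat_sum by (intro borel_measurable_sum) auto
qed

section \<open>Counters at random times, on trace sigma-algebras\<close>

abbreviation G :: "mindex \<Rightarrow> 'w set \<Rightarrow> 'w measure" where
  "G a B \<equiv> restrict_space (F a) B"

lemma space_G: "B \<subseteq> \<Omega>\<^sub>0 \<Longrightarrow> space (G a B) = B"
  using good_subset by (auto simp: space_restrict_space)

text \<open>Carries measurability on a part \<open>B\<close> back to events of
  \<open>F a\<close>.\<close>

lemma sets_G: "B \<in> sets (F a) \<Longrightarrow> A \<in> sets (G a B) \<Longrightarrow> A \<in> sets (F a)"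
  by (subst (asm) sets_restrict_space_iff) auto

lemma xi_G:
  "i < buffers N \<Longrightarrow> k \<le> fst a i \<Longrightarrow> xi N r i k \<in> borel_measurable (G a B)"
  by (rule measurable_restrict_space1[OF xi_F])

lemma eta_G:
  "j < activities N \<Longrightarrow> k \<le> snd a j \<Longrightarrow> eta N r j k \<in> borel_measurable (G a B)"
  by (rule measurable_restrict_space1[OF eta_F])

lemma Routed_G:
  "i < buffers N \<Longrightarrow> j < activities N \<Longrightarrow> k \<le> snd a j \<Longrightarrow>
    (\<lambda>\<omega>. real (Routed N r j i k \<omega>)) \<in> borel_measurable (G a B)"
  by (rule measurable_restrict_space1[OF Routed_F])

lemma Ecount_G:
  assumes B: "B \<subseteq> \<Omega>\<^sub>0" and i: "i < buffers N" and x: "x \<in> borel_measurable (G a B)"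
    and nonneg: "\<And>\<omega>. \<omega> \<in> B \<Longrightarrow> 0 \<le> x \<omega>" and bnd: "\<And>\<omega>. \<omega> \<in> B \<Longrightarrow> below N r T a (x \<omega>) \<omega>"
  shows "(\<lambda>\<omega>. Ecount N r i (x \<omega>) \<omega>) \<in> measurable (G a B) (count_space {..<fst a i})"
proof (rule measurable_level_count[where f = "xi N r i" and x = "\<lambda>\<omega>. ereal (x \<omega>)"])
  fix \<omega> k assume "\<omega> \<in> space (G a B)"
  then have \<omega>: "\<omega> \<in> B" using space_G[OF B] by simp
  then interpret good_path N r T D h \<omega> using B good by blast
  show "Ecount N r i (x \<omega>) \<omega> < fst a i"
    using bnd[OF \<omega>] i by (simp add: below_def)
  show "k \<le> Ecount N r i (x \<omega>) \<omega> \<longleftrightarrow> xi N r i k \<omega> \<le> ereal (x \<omega>)"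
    by (rule le_E[OF nonneg[OF \<omega>]])
qed (use xi_G[OF i] x in simp_all)

text \<open>The measurability of \<open>T\<close> at the random time is a hypothesis here; at event
  times it is supplied by the recursion over events.\<close>

lemma Scount_G:
  assumes B: "B \<subseteq> \<Omega>\<^sub>0" and j: "j < activities N"
    and y: "(\<lambda>\<omega>. T j (x \<omega>) \<omega>) \<in> borel_measurable (G a B)"
    and nonneg: "\<And>\<omega>. \<omega> \<in> B \<Longrightarrow> 0 \<le> x \<omega>" and bnd: "\<And>\<omega>. \<omega> \<in> B \<Longrightarrow> below N r T a (x \<omega>) \<omega>"
  shows "(\<lambda>\<omega>. Scount N r j (T j (x \<omega>) \<omega>) \<omega>) \<in> measurable (G a B) (count_space {..<snd a j})"
proof (rule measurable_level_count[where f = "eta N r j" and x = "\<lambda>\<omega>. T j (x \<omega>) \<omega>"])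
  fix \<omega> k assume "\<omega> \<in> space (G a B)"
  then have \<omega>: "\<omega> \<in> B" using space_G[OF B] by simp
  then interpret good_path N r T D h \<omega> using B good by blast
  show "Scount N r j (T j (x \<omega>) \<omega>) \<omega> < snd a j"
    using bnd[OF \<omega>] j by (simp add: below_def)
  show "k \<le> Scount N r j (T j (x \<omega>) \<omega>) \<omega> \<longleftrightarrow> eta N r j k \<omega> \<le> T j (x \<omega>) \<omega>"
    by (rule le_S[OF j nonneg[OF \<omega>]])
qed (use eta_G[OF j] y in simp_all)

text \<open>The counter takes finitely many values \<open>k < fst a i\<close>, and for each of them
  the sum with index \<open>k + 1 \<le> fst a i\<close> is measurable.\<close>

lemma next_arrival_G:
  assumes "B \<subseteq> \<Omega>\<^sub>0" "i < buffers N" "x \<in> borel_measurable (G a B)"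
    and "\<And>\<omega>. \<omega> \<in> B \<Longrightarrow> 0 \<le> x \<omega>" "\<And>\<omega>. \<omega> \<in> B \<Longrightarrow> below N r T a (x \<omega>) \<omega>"
  shows "(\<lambda>\<omega>. xi N r i (Ecount N r i (x \<omega>) \<omega> + 1) \<omega>) \<in> borel_measurable (G a B)"
  by (rule measurable_compose_countable'[OF _ Ecount_G[OF assms]])
     (use xi_G[OF assms(2)] in simp_all)

lemma next_service_G:
  assumes "B \<subseteq> \<Omega>\<^sub>0" "j < activities N" "(\<lambda>\<omega>. T j (x \<omega>) \<omega>) \<in> borel_measurable (G a B)"
    and "\<And>\<omega>. \<omega> \<in> B \<Longrightarrow> 0 \<le> x \<omega>" "\<And>\<omega>. \<omega> \<in> B \<Longrightarrow> below N r T a (x \<omega>) \<omega>"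
  shows "(\<lambda>\<omega>. eta N r j (Scount N r j (T j (x \<omega>) \<omega>) \<omega> + 1) \<omega>) \<in> borel_measurable (G a B)"
  by (rule measurable_compose_countable'[OF _ Scount_G[OF assms]])
     (use eta_G[OF assms(2)] in simp_all)

lemma Queue_G:
  assumes B: "B \<subseteq> \<Omega>\<^sub>0" and i: "i < buffers N" and x: "x \<in> borel_measurable (G a B)"
    and y: "\<And>j. j < activities N \<Longrightarrow> (\<lambda>\<omega>. T j (x \<omega>) \<omega>) \<in> borel_measurable (G a B)"
    and nonneg: "\<And>\<omega>. \<omega> \<in> B \<Longrightarrow> 0 \<le> x \<omega>" and bnd: "\<And>\<omega>. \<omega> \<in> B \<Longrightarrow> below N r T a (x \<omega>) \<omega>"
  shows "(\<lambda>\<omega>. Queue N r T i (x \<omega>) \<omega>) \<in> borel_measurable (G a B)"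
proof -
  have "(\<lambda>\<omega>. real (Ecount N r i (x \<omega>) \<omega>)) \<in> borel_measurable (G a B)"
    by (rule measurable_compose[OF Ecount_G[OF B i x nonneg bnd]]) auto
  moreover have "(\<lambda>\<omega>. real (Scount N r j (T j (x \<omega>) \<omega>) \<omega>)) \<in> borel_measurable (G a B)"
    if "j < activities N" for j
    by (rule measurable_compose[OF Scount_G[OF B that y[OF that] nonneg bnd]]) auto
  moreover have "(\<lambda>\<omega>. real (Routed N r j i (Scount N r j (T j (x \<omega>) \<omega>) \<omega>) \<omega>)) \<in> borel_measurable (G a B)"
    if j: "j < activities N" for j
    by (rule measurable_compose_countable'[OF _ Scount_G[OF B j y[OF j] nonneg bnd],
          where f = "\<lambda>k \<omega>. real (Routed N r j i k \<omega>)"])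
       (use Routed_G[OF i j] in simp_all)
  ultimately show ?thesis
    unfolding Queue_def
    by (intro borel_measurable_add borel_measurable_diff borel_measurable_sum borel_measurable_times
          borel_measurable_const) auto
qed

lemma below_F:
  assumes B: "B \<in> sets (F a)" "B \<subseteq> \<Omega>\<^sub>0" and x: "x \<in> borel_measurable (G a B)"
    and y: "\<And>j. j < activities N \<Longrightarrow> (\<lambda>\<omega>. T j (x \<omega>) \<omega>) \<in> borel_measurable (G a B)"
    and nonneg: "\<And>\<omega>. \<omega> \<in> B \<Longrightarrow> 0 \<le> x \<omega>"
  shows "{\<omega>\<in>B. below N r T a (x \<omega>) \<omega>} \<in> sets (F a)"
proof (rule sets_G[OF B(1)])
  have "{\<omega>\<in>B. below N r T a (x \<omega>) \<omega>} =
    {\<omega>\<in>space (G a B). (\<forall>i\<in>{..<buffers N}. ereal (x \<omega>) < xi N r i (fst a i) \<omega>) \<and>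
     (\<forall>j\<in>{..<activities N}. T j (x \<omega>) \<omega> < eta N r j (snd a j) \<omega>)}"
    unfolding space_G[OF B(2)]
    using good_path.below_iff[OF good nonneg] B(2) by (intro Collect_cong) (blast dest: subsetD)
  also have "\<dots> \<in> sets (G a B)"
    using x y xi_G eta_G
    by (intro sets.sets_Collect_conj sets.sets_Collect_finite_All borel_measurable_less
          borel_measurable_ereal finite_lessThan) simp_all
  finally show "{\<omega>\<in>B. below N r T a (x \<omega>) \<omega>} \<in> sets (G a B)" .
qed

section \<open>Induction over the event times\<close>

definition reach :: "mindex \<Rightarrow> nat \<Rightarrow> 'w set" where
  "reach a l = {\<omega>\<in>\<Omega>\<^sub>0. below N r T a (Upsilon N r T \<omega> l) \<omega>}"

text \<open>The induction invariant. It carries the whole history because \<open>h l\<close> reads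
  all of it; the allocation \<open>D\<close> chosen at event \<open>l\<close> then follows.\<close>

definition known :: "mindex \<Rightarrow> nat \<Rightarrow> 'w set \<Rightarrow> bool" where
  "known a l B \<longleftrightarrow>
     (\<lambda>\<omega>. Upsilon N r T \<omega> l) \<in> borel_measurable (G a B) \<and>
     (\<forall>j<activities N. (\<lambda>\<omega>. T j (Upsilon N r T \<omega> l) \<omega>) \<in> borel_measurable (G a B)) \<and>
     history N r T D l \<in> measurable (G a B) (history_space N l)"

lemma reach_good: "reach a l \<subseteq> \<Omega>\<^sub>0"
  by (auto simp: reach_def)

lemma reach_Suc: "reach a (Suc l) \<subseteq> reach a l"
proof
  fix \<omega> assume \<omega>: "\<omega> \<in> reach a (Suc l)"
  then interpret good_path N r T D h \<omega> using good reach_good by blast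
  show "\<omega> \<in> reach a l"
    using \<omega> below_antimono[OF _ Upsilon_nonneg less_imp_le[OF Upsilon_less_Suc], of a l]
    unfolding reach_def by blast
qed

lemma Upsilon_good_nonneg: "\<omega> \<in> \<Omega>\<^sub>0 \<Longrightarrow> 0 \<le> Upsilon N r T \<omega> l"
  by (rule good_path.Upsilon_nonneg[OF good])

text \<open>A snapshot contains the allocation of the preceding event, not the one chosen now. This
  is why \<open>D\<close> is only required for the predecessor of \<open>l\<close>, and why the
  recursion is not circular.\<close>

lemma snapshot_G:
  assumes B: "B \<subseteq> reach a l"
    and x: "(\<lambda>\<omega>. Upsilon N r T \<omega> l) \<in> borel_measurable (G a B)"
    and y: "\<And>j. j < activities N \<Longrightarrow> (\<lambda>\<omega>. T j (Upsilon N r T \<omega> l) \<omega>) \<in> borel_measurable (G a B)"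
    and D: "\<And>k j. l = Suc k \<Longrightarrow> j < activities N \<Longrightarrow>
              (\<lambda>\<omega>. D j (Upsilon N r T \<omega> k) \<omega>) \<in> borel_measurable (G a B)"
  shows "snapshot N r T D l \<in> measurable (G a B) (snapshot_space N)"
proof -
  have B0: "B \<subseteq> \<Omega>\<^sub>0"
    using B reach_good by blast
  have nonneg: "0 \<le> Upsilon N r T \<omega> l" if "\<omega> \<in> B" for \<omega>
    using B0 that Upsilon_good_nonneg by blast
  have bnd: "below N r T a (Upsilon N r T \<omega> l) \<omega>" if "\<omega> \<in> B" for \<omega>
    using B that by (auto simp: reach_def)
  have arrivals: "(\<lambda>\<omega>. \<lambda>i\<in>{..<buffers N}. xi N r i (Ecount N r i (Upsilon N r T \<omega> l) \<omega> + 1) \<omega>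
      - ereal (Upsilon N r T \<omega> l)) \<in> measurable (G a B) (\<Pi>\<^sub>M i\<in>{..<buffers N}. borel)"
  proof (rule measurable_restrict)
    fix i assume "i \<in> {..<buffers N}"
    then have i: "i < buffers N" by simp
    show "(\<lambda>\<omega>. xi N r i (Ecount N r i (Upsilon N r T \<omega> l) \<omega> + 1) \<omega> - ereal (Upsilon N r T \<omega> l))
        \<in> borel_measurable (G a B)"
      by (rule borel_measurable_ereal_diff[OF next_arrival_G[OF B0 i x nonneg bnd]
            borel_measurable_ereal[OF x]])
  qed
  have services: "(\<lambda>\<omega>. \<lambda>j\<in>{..<activities N}.
      eta N r j (Scount N r j (T j (Upsilon N r T \<omega> l) \<omega>) \<omega> + 1) \<omega> - T j (Upsilon N r T \<omega> l) \<omega>)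
      \<in> measurable (G a B) (\<Pi>\<^sub>M j\<in>{..<activities N}. borel)"
  proof (rule measurable_restrict)
    fix j assume "j \<in> {..<activities N}"
    then have j: "j < activities N" by simp
    show "(\<lambda>\<omega>. eta N r j (Scount N r j (T j (Upsilon N r T \<omega> l) \<omega>) \<omega> + 1) \<omega>
        - T j (Upsilon N r T \<omega> l) \<omega>) \<in> borel_measurable (G a B)"
      by (rule borel_measurable_diff[OF next_service_G[OF B0 j y[OF j] nonneg bnd] y[OF j]])
  qed
  have queues: "(\<lambda>\<omega>. \<lambda>i\<in>{..<buffers N}. if l = 0 then 0 else Queue N r T i (Upsilon N r T \<omega> l) \<omega>)
      \<in> measurable (G a B) (\<Pi>\<^sub>M i\<in>{..<buffers N}. borel)"
  proof (rule measurable_restrict)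
    fix i assume "i \<in> {..<buffers N}"
    then have i: "i < buffers N" by simp
    show "(\<lambda>\<omega>. if l = 0 then 0 else Queue N r T i (Upsilon N r T \<omega> l) \<omega>) \<in> borel_measurable (G a B)"
      using Queue_G[OF B0 i x y nonneg bnd] by (cases "l = 0") simp_all
  qed
  have rates: "(\<lambda>\<omega>. \<lambda>j\<in>{..<activities N}. case l of 0 \<Rightarrow> 0 | Suc k \<Rightarrow> D j (Upsilon N r T \<omega> k) \<omega>)
      \<in> measurable (G a B) (\<Pi>\<^sub>M j\<in>{..<activities N}. borel)"
  proof (rule measurable_restrict)
    fix j assume "j \<in> {..<activities N}"
    then show "(\<lambda>\<omega>. case l of 0 \<Rightarrow> 0 | Suc k \<Rightarrow> D j (Upsilon N r T \<omega> k) \<omega>) \<in> borel_measurable (G a B)"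
      using D by (cases l) simp_all
  qed
  note components = measurable_Pair[OF x measurable_Pair[OF arrivals
        measurable_Pair[OF services measurable_Pair[OF queues rates]]]]
  show ?thesis
    unfolding snapshot_space_def
    by (rule measurable_cong[THEN iffD2, OF _ components]) (simp only: snapshot_def Let_def)
qed

lemma D_known:
  assumes "B \<subseteq> \<Omega>\<^sub>0" and "known a l B" and "j < activities N"
  shows "(\<lambda>\<omega>. D j (Upsilon N r T \<omega> l) \<omega>) \<in> borel_measurable (G a B)"
proof -
  have "(\<lambda>\<omega>. h l j (history N r T D l \<omega>)) \<in> borel_measurable (G a B)"
    using assms(2) by (intro measurable_compose[OF _ h_measurable[OF assms(3)]]) (simp add: known_def)
  moreover have "D j (Upsilon N r T \<omega> l) \<omega> = h l j (history N r T D l \<omega>)"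
    if "\<omega> \<in> space (G a B)" for \<omega>
    using that assms space_G by (intro good_path.D_Upsilon[OF good]) auto
  ultimately show ?thesis
    by (simp cong: measurable_cong)
qed

text \<open>Measurability holds on all of \<open>reach a l\<close>: the next event time is decided
  before it is known whether the counters are still below \<open>a\<close> at it. This is what puts
  \<open>reach a (Suc l)\<close> into \<open>F a\<close>.\<close>

lemma Upsilon_Suc_known:
  assumes known: "known a l (reach a l)"
  shows "(\<lambda>\<omega>. Upsilon N r T \<omega> (Suc l)) \<in> borel_measurable (G a (reach a l))"
    and "j < activities N \<Longrightarrow>
      (\<lambda>\<omega>. T j (Upsilon N r T \<omega> (Suc l)) \<omega>) \<in> borel_measurable (G a (reach a l))"
proof -
  let ?A = "reach a l"
  let ?w = "\<lambda>i \<omega>. xi N r i (Ecount N r i (Upsilon N r T \<omega> l) \<omega> + 1) \<omega>"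
  let ?z = "\<lambda>j \<omega>. Upsilon N r T \<omega> l +
    (eta N r j (Scount N r j (T j (Upsilon N r T \<omega> l) \<omega>) \<omega> + 1) \<omega> - T j (Upsilon N r T \<omega> l) \<omega>)"
  let ?D = "\<lambda>j \<omega>. D j (Upsilon N r T \<omega> l) \<omega>"
  have x: "(\<lambda>\<omega>. Upsilon N r T \<omega> l) \<in> borel_measurable (G a ?A)"
    and y: "\<And>j. j < activities N \<Longrightarrow> (\<lambda>\<omega>. T j (Upsilon N r T \<omega> l) \<omega>) \<in> borel_measurable (G a ?A)"
    using known by (auto simp: known_def)
  have nonneg: "0 \<le> Upsilon N r T \<omega> l" and bnd: "below N r T a (Upsilon N r T \<omega> l) \<omega>"
    if "\<omega> \<in> ?A" for \<omega>
    using that Upsilon_good_nonneg by (auto simp: reach_def)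
  note D = D_known[OF reach_good known]
  have w: "?w i \<in> borel_measurable (G a ?A)" if "i < buffers N" for i
    by (rule next_arrival_G[OF reach_good that x nonneg bnd])
  have z: "?z j \<in> borel_measurable (G a ?A)" if "j < activities N" for j
    by (intro borel_measurable_add borel_measurable_diff x y that
          next_service_G[OF reach_good that y nonneg bnd])
  show Ups: "(\<lambda>\<omega>. Upsilon N r T \<omega> (Suc l)) \<in> borel_measurable (G a ?A)"
  proof (subst borel_measurable_iff_ge, intro allI)
    \<comment> \<open>\<open>le_Upsilon_Suc_iff\<close> reduces superlevel sets to finitely many
      conditions on data known at event \<open>l\<close>.\<close>
    fix b :: real
    have "{\<omega>\<in>space (G a ?A). b \<le> Upsilon N r T \<omega> (Suc l)} =
      {\<omega>\<in>space (G a ?A). (\<forall>i\<in>{..<buffers N}. ereal b \<le> ?w i \<omega>) \<and>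
         (\<forall>j\<in>{..<activities N}. ?D j \<omega> = 1 \<longrightarrow> b \<le> ?z j \<omega>)}"
      unfolding space_G[OF reach_good]
      using good_path.le_Upsilon_Suc_iff[OF good, of _ b l] reach_good[of a l]
      by (intro Collect_cong) (simp only: lessThan_iff Ball_def cong: conj_cong, blast)
    also have "\<dots> \<in> sets (G a ?A)"
      using w z D
      by (intro sets.sets_Collect_conj sets.sets_Collect_finite_All sets.sets_Collect_imp
            borel_measurable_le borel_measurable_eq borel_measurable_const finite_lessThan)
         (simp_all only: lessThan_iff)
    finally show "{\<omega>\<in>space (G a ?A). b \<le> Upsilon N r T \<omega> (Suc l)} \<in> sets (G a ?A)" .
  qed
  show "(\<lambda>\<omega>. T j (Upsilon N r T \<omega> (Suc l)) \<omega>) \<in> borel_measurable (G a ?A)"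
    if j: "j < activities N"
  proof -
    have "(\<lambda>\<omega>. T j (Upsilon N r T \<omega> l) \<omega> +
        ?D j \<omega> * (Upsilon N r T \<omega> (Suc l) - Upsilon N r T \<omega> l)) \<in> borel_measurable (G a ?A)"
      by (intro borel_measurable_add borel_measurable_times borel_measurable_diff x y D j Ups)
    moreover have "T j (Upsilon N r T \<omega> (Suc l)) \<omega> = T j (Upsilon N r T \<omega> l) \<omega> +
        ?D j \<omega> * (Upsilon N r T \<omega> (Suc l) - Upsilon N r T \<omega> l)" if "\<omega> \<in> space (G a ?A)" for \<omega>
      using that subsetD[OF reach_good[of a l], of \<omega>]
      by (intro good_path.T_Upsilon_Suc[OF good j]) (simp add: space_G[OF reach_good])
    ultimately show ?thesis
      by (simp cong: measurable_cong del: Upsilon.simps)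
  qed
qed

text \<open>Both claims advance together: the new time on the old set gives the new set, and on the
  new set the counters are small enough for the new snapshot to be measurable.\<close>

lemma reach_known: "reach a l \<in> sets (F a) \<and> known a l (reach a l)"
proof (induction l)
  case 0
  \<comment> \<open>Stated for general \<open>B\<close>, since it serves first on
    \<open>\<Omega>\<^sub>0\<close> and then on \<open>reach a 0\<close>.\<close>
  have T0: "(\<lambda>\<omega>. T j (Upsilon N r T \<omega> 0) \<omega>) \<in> borel_measurable (G a B)"
    if "B \<subseteq> \<Omega>\<^sub>0" "j < activities N" for B j
  proof -
    have "T j (Upsilon N r T \<omega> 0) \<omega> = 0" if "\<omega> \<in> space (G a B)" for \<omega>
      using that \<open>B \<subseteq> \<Omega>\<^sub>0\<close> good_path.T_0[OF good \<open>j < activities N\<close>] space_G by auto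
    then show ?thesis by (simp cong: measurable_cong)
  qed
  have "reach a 0 \<in> sets (F a)"
    unfolding reach_def using good_F T0[OF order_refl] by (intro below_F) auto
  moreover have "history N r T D 0 \<in> measurable (G a (reach a 0)) (history_space N 0)"
    unfolding history_def[abs_def] history_space_def
    using T0[OF reach_good[of a 0]] by (intro measurable_restrict) (auto intro!: snapshot_G)
  ultimately show ?case
    using T0[OF reach_good[of a 0]] by (simp add: known_def)
next
  case (Suc l)
  let ?A = "reach a l" and ?B = "reach a (Suc l)"
  have known: "known a l ?A" using Suc.IH by simp
  note mono = measurable_restrict_mono[OF _ reach_Suc]
  have "?B = {\<omega>\<in>?A. below N r T a (Upsilon N r T \<omega> (Suc l)) \<omega>}"
    using reach_Suc[of a l] unfolding reach_def by blast
  also have "\<dots> \<in> sets (F a)"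
  proof (rule below_F)
    fix \<omega> assume "\<omega> \<in> ?A"
    then show "0 \<le> Upsilon N r T \<omega> (Suc l)"
      using reach_good by (intro Upsilon_good_nonneg) blast
  qed (use Suc.IH reach_good Upsilon_Suc_known[OF known] in blast)+
  finally have B: "?B \<in> sets (F a)" .
  have x: "(\<lambda>\<omega>. Upsilon N r T \<omega> (Suc l)) \<in> borel_measurable (G a ?B)"
    by (rule mono[OF Upsilon_Suc_known(1)[OF known]])
  have y: "(\<lambda>\<omega>. T j (Upsilon N r T \<omega> (Suc l)) \<omega>) \<in> borel_measurable (G a ?B)"
    if "j < activities N" for j
    by (rule mono[OF Upsilon_Suc_known(2)[OF known that]])
  have snap: "snapshot N r T D (Suc l) \<in> measurable (G a ?B) (snapshot_space N)"
    using mono[OF D_known[OF reach_good known]] by (intro snapshot_G[OF order_refl x y]) auto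
  have hist: "history N r T D l \<in> measurable (G a ?B) (history_space N l)"
    using known by (intro mono) (auto simp: known_def)
  \<comment> \<open>Earlier snapshots are coordinates of the known history; only the last one is
    new.\<close>
  have "snapshot N r T D k \<in> measurable (G a ?B) (snapshot_space N)" if "k \<le> Suc l" for k
  proof (cases "k = Suc l")
    case True
    then show ?thesis using snap by simp
  next
    case False
    then have "k \<in> {..l}" using that by simp
    from measurable_compose[OF hist[unfolded history_space_def] measurable_component_singleton[OF this]]
    show ?thesis using \<open>k \<in> {..l}\<close> by (simp add: history_def)
  qed
  then have "history N r T D (Suc l) \<in> measurable (G a ?B) (history_space N (Suc l))"
    unfolding history_def[abs_def] history_space_def by (intro measurable_restrict) auto
  then show ?case
    using B x y by (simp add: known_def del: Upsilon.simps)
qed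

section \<open>Stopping times at fixed times\<close>

text \<open>The counters are bounded at the \<open>l\<close>-th event only. The bound at
  \<open>s\<close> itself is imposed afterwards, once \<open>T j s\<close> is measurable on the
  piece.\<close>

definition piece :: "mindex \<Rightarrow> real \<Rightarrow> nat \<Rightarrow> 'w set" where
  "piece a s l = {\<omega>\<in>reach a l. Upsilon N r T \<omega> l \<le> s \<and> s < Upsilon N r T \<omega> (Suc l)}"

lemma piece_reach: "piece a s l \<subseteq> reach a l"
  by (auto simp: piece_def)

lemma piece_good: "piece a s l \<subseteq> \<Omega>\<^sub>0"
  using piece_reach reach_good by (rule order_trans)

lemma piece_F: "piece a s l \<in> sets (F a)"
proof (rule sets_G)
  show "reach a l \<in> sets (F a)"
    using reach_known by simp
  have known: "known a l (reach a l)"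
    using reach_known by simp
  have x: "(\<lambda>\<omega>. Upsilon N r T \<omega> l) \<in> borel_measurable (G a (reach a l))"
    using known by (simp add: known_def)
  have "piece a s l = {\<omega>\<in>space (G a (reach a l)). Upsilon N r T \<omega> l \<le> s \<and> s < Upsilon N r T \<omega> (Suc l)}"
    unfolding piece_def space_G[OF reach_good] ..
  also have "\<dots> \<in> sets (G a (reach a l))"
    by (intro sets.sets_Collect_conj borel_measurable_le borel_measurable_less borel_measurable_const
          x Upsilon_Suc_known(1)[OF known])
  finally show "piece a s l \<in> sets (G a (reach a l))" .
qed

lemma T_piece:
  assumes j: "j < activities N"
  shows "T j s \<in> borel_measurable (G a (piece a s l))"
proof -
  have known: "known a l (reach a l)"
    using reach_known by simp
  note mono = measurable_restrict_mono[OF _ piece_reach]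
  have x: "(\<lambda>\<omega>. Upsilon N r T \<omega> l) \<in> borel_measurable (G a (piece a s l))"
    and y: "(\<lambda>\<omega>. T j (Upsilon N r T \<omega> l) \<omega>) \<in> borel_measurable (G a (piece a s l))"
    using known j by (auto simp: known_def intro: mono)
  have "(\<lambda>\<omega>. T j (Upsilon N r T \<omega> l) \<omega> + D j (Upsilon N r T \<omega> l) \<omega> * (s - Upsilon N r T \<omega> l))
      \<in> borel_measurable (G a (piece a s l))"
    by (intro borel_measurable_add borel_measurable_times borel_measurable_diff borel_measurable_const
          x y mono[OF D_known[OF reach_good known j]])
  moreover have "T j s \<omega> = T j (Upsilon N r T \<omega> l) \<omega> + D j (Upsilon N r T \<omega> l) \<omega> * (s - Upsilon N r T \<omega> l)"
    if "\<omega> \<in> space (G a (piece a s l))" for \<omega>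
  proof -
    have "\<omega> \<in> piece a s l"
      using that by (simp add: space_G[OF piece_good])
    then show ?thesis
      using subsetD[OF piece_good] by (intro good_path.T_affine[OF good j]) (auto simp: piece_def simp del: Upsilon.simps)
  qed
  ultimately show ?thesis
    by (simp cong: measurable_cong)
qed

text \<open>Some event is the last one up to \<open>s\<close>, and counters below \<open>a\<close>
  at \<open>s\<close> were below \<open>a\<close> at that event. The free predicate \<open>P\<close>
  covers both the stopping event and conditions on \<open>T j s\<close>.\<close>

lemma below_good_decompose:
  assumes "0 \<le> s"
  shows "{\<omega>\<in>\<Omega>\<^sub>0. below N r T a s \<omega> \<and> P \<omega>} = (\<Union>l. {\<omega>\<in>piece a s l. below N r T a s \<omega> \<and> P \<omega>})"
proof (intro equalityI subsetI)
  fix \<omega> assume \<omega>: "\<omega> \<in> {\<omega>\<in>\<Omega>\<^sub>0. below N r T a s \<omega> \<and> P \<omega>}"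
  then interpret good_path N r T D h \<omega> using good by blast
  obtain l where l: "\<upsilon> l \<le> s" "s < \<upsilon> (Suc l)"
    using ex_Upsilon_interval[OF assms] by blast
  have "below N r T a (\<upsilon> l) \<omega>"
    using below_antimono[OF _ Upsilon_nonneg l(1)] \<omega> by blast
  then show "\<omega> \<in> (\<Union>l. {\<omega>\<in>piece a s l. below N r T a s \<omega> \<and> P \<omega>})"
    using \<omega> l unfolding piece_def reach_def by blast
next
  fix \<omega> assume "\<omega> \<in> (\<Union>l. {\<omega>\<in>piece a s l. below N r T a s \<omega> \<and> P \<omega>})"
  then show "\<omega> \<in> {\<omega>\<in>\<Omega>\<^sub>0. below N r T a s \<omega> \<and> P \<omega>}"
    using piece_good by blast
qed

lemma below_piece:
  assumes "0 \<le> s"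
  shows "{\<omega>\<in>piece a s l. below N r T a s \<omega>} \<in> sets (F a)"
  by (rule below_F[OF piece_F piece_good borel_measurable_const T_piece assms])

lemma below_good:
  assumes "0 \<le> s"
  shows "{\<omega>\<in>\<Omega>\<^sub>0. below N r T a s \<omega>} \<in> sets (F a)"
proof -
  have "(\<Union>l. {\<omega>\<in>piece a s l. below N r T a s \<omega>}) \<in> sets (F a)"
    by (intro sets.countable_UN) (auto intro: below_piece assms)
  then show ?thesis
    using below_good_decompose[OF assms, of a "\<lambda>_. True"] by simp
qed

lemma below_T_good:
  assumes s: "0 \<le> s" and j: "j < activities N" and X: "X \<in> sets borel"
  shows "{\<omega>\<in>\<Omega>\<^sub>0. below N r T a s \<omega> \<and> T j s \<omega> \<in> X} \<in> sets (F a)"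
proof -
  have "{\<omega>\<in>piece a s l. below N r T a s \<omega> \<and> T j s \<omega> \<in> X} \<in> sets (F a)" for l
  proof -
    have "T j s -` X \<inter> space (G a (piece a s l)) \<in> sets (F a)"
      by (rule sets_G[OF piece_F measurable_sets[OF T_piece[OF j] X]])
    then have "{\<omega>\<in>piece a s l. below N r T a s \<omega>} \<inter> (T j s -` X \<inter> piece a s l) \<in> sets (F a)"
      unfolding space_G[OF piece_good] using below_piece[OF s] by (rule sets.Int[rotated])
    moreover have "{\<omega>\<in>piece a s l. below N r T a s \<omega>} \<inter> (T j s -` X \<inter> piece a s l) =
        {\<omega>\<in>piece a s l. below N r T a s \<omega> \<and> T j s \<omega> \<in> X}"
      by blast
    ultimately show ?thesis by simp
  qed
  then have "(\<Union>l. {\<omega>\<in>piece a s l. below N r T a s \<omega> \<and> T j s \<omega> \<in> X}) \<in> sets (F a)"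
    by (intro sets.countable_UN) auto
  then show ?thesis
    unfolding below_good_decompose[OF s] .
qed

section \<open>From good sample points to the whole space\<close>

lemma Ecount_measurable: "(\<lambda>\<omega>. Ecount N r i s \<omega>) \<in> measurable (prob_sp N) (count_space UNIV)"
proof -
  have "xi N r i m \<in> borel_measurable (prob_sp N)" for m
    unfolding xi_def[abs_def] using interarrival_measurable by (intro borel_measurable_ereal_sum) auto
  then show ?thesis
    unfolding Ecount_def
    by (intro measurable_Max_nat) (simp add: pred_def)
qed

lemma Scount_measurable:
  assumes "j < activities N" and "0 \<le> s"
  shows "(\<lambda>\<omega>. Scount N r j (T j s \<omega>) \<omega>) \<in> measurable (prob_sp N) (count_space UNIV)"
proof -
  have "eta N r j m \<in> borel_measurable (prob_sp N)" for m
    unfolding eta_def[abs_def] using service_measurable[OF assms(1)]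
    by (intro borel_measurable_sum) auto
  then show ?thesis
    using T_measurable[OF assms] unfolding Scount_def
    by (intro measurable_Max_nat) (simp add: pred_def)
qed

text \<open>Covers irregular points as well, where \<open>Max\<close> may be unspecified; with it,
  assumption \<open>bad\<close> applies to the part of the event outside
  \<open>\<Omega>\<^sub>0\<close>.\<close>

lemma below_measurable:
  assumes "0 \<le> s"
  shows "{\<omega>\<in>\<Omega> N. below N r T a s \<omega>} \<in> sets (prob_sp N)"
proof -
  have E: "{\<omega>\<in>\<Omega> N. Ecount N r i s \<omega> < fst a i} \<in> sets (prob_sp N)" for i
    using measurable_sets[OF Ecount_measurable[of i s], of "{..<fst a i}"]
    by (simp add: vimage_def Int_def conj_commute)
  have S: "{\<omega>\<in>\<Omega> N. Scount N r j (T j s \<omega>) \<omega> < snd a j} \<in> sets (prob_sp N)"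
    if "j < activities N" for j
    using measurable_sets[OF Scount_measurable[OF that assms], of "{..<snd a j}"]
    by (simp add: vimage_def Int_def conj_commute)
  have "{\<omega>\<in>\<Omega> N. below N r T a s \<omega>} =
    {\<omega>\<in>\<Omega> N. (\<forall>i\<in>{..<buffers N}. Ecount N r i s \<omega> < fst a i) \<and>
      (\<forall>j\<in>{..<activities N}. Scount N r j (T j s \<omega>) \<omega> < snd a j)}"
    by (auto simp: below_def)
  also have "\<dots> \<in> sets (prob_sp N)"
    by (rule sets.sets_Collect_conj; rule sets.sets_Collect_finite_All) (use E S in simp_all)
  finally show ?thesis .
qed

lemma F_split:
  assumes "A \<in> sets (prob_sp N)" and "A \<inter> \<Omega>\<^sub>0 \<in> sets (F a)"
  shows "A \<in> sets (F a)"
proof -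
  have "A - \<Omega>\<^sub>0 \<in> sets (F a)"
    using assms good_sets by (intro bad_F) auto
  with assms(2) have "A \<inter> \<Omega>\<^sub>0 \<union> (A - \<Omega>\<^sub>0) \<in> sets (F a)"
    by (rule sets.Un)
  then show ?thesis
    by (simp add: Int_Diff_Un)
qed

lemma below_stop:
  assumes "0 \<le> s"
  shows "{\<omega>\<in>\<Omega> N. below N r T a s \<omega>} \<in> sets (F a)"
proof (rule F_split[OF below_measurable[OF assms]])
  have "{\<omega>\<in>\<Omega> N. below N r T a s \<omega>} \<inter> \<Omega>\<^sub>0 = {\<omega>\<in>\<Omega>\<^sub>0. below N r T a s \<omega>}"
    using good_subset by blast
  then show "{\<omega>\<in>\<Omega> N. below N r T a s \<omega>} \<inter> \<Omega>\<^sub>0 \<in> sets (F a)"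
    using below_good[OF assms] by simp
qed

lemma below_T_stop:
  assumes s: "0 \<le> s" and j: "j < activities N" and X: "X \<in> sets borel"
  shows "(T j s -` X \<inter> \<Omega> N) \<inter> {\<omega>\<in>\<Omega> N. below N r T a s \<omega>} \<in> sets (F a)"
proof (rule F_split)
  show "(T j s -` X \<inter> \<Omega> N) \<inter> {\<omega>\<in>\<Omega> N. below N r T a s \<omega>} \<in> sets (prob_sp N)"
    by (rule sets.Int[OF measurable_sets[OF T_measurable[OF j s] X] below_measurable[OF s]])
  have "(T j s -` X \<inter> \<Omega> N) \<inter> {\<omega>\<in>\<Omega> N. below N r T a s \<omega>} \<inter> \<Omega>\<^sub>0 =
      {\<omega>\<in>\<Omega>\<^sub>0. below N r T a s \<omega> \<and> T j s \<omega> \<in> X}"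
    using good_subset by blast
  then show "(T j s -` X \<inter> \<Omega> N) \<inter> {\<omega>\<in>\<Omega> N. below N r T a s \<omega>} \<inter> \<Omega>\<^sub>0 \<in> sets (F a)"
    using below_T_good[OF s j X] by simp
qed

lemma stopping_time:
  assumes "0 \<le> t"
  shows "mp_stopping_time N r Z (sigma0 N r T t)"
  unfolding mp_stopping_time_def mindex_le_sigma0 sets_F[symmetric]
  using assms by (simp add: sigma0_mindices below_stop)

section \<open>The stopped sigma-algebras and adaptedness\<close>

definition F_all :: "'w measure" where
  "F_all = sigma (\<Omega> N) (\<Union>a\<in>mindices N. Filt N r Z a)"

lemma Filt_Pow: "(\<Union>a\<in>mindices N. Filt N r Z a) \<subseteq> Pow (\<Omega> N)"
  unfolding sets_F[symmetric] using sets.sets_into_space[of _ "F _"] by auto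

lemma space_F_all [simp]: "space F_all = \<Omega> N"
  unfolding F_all_def using Filt_Pow by (rule space_measure_of)

lemma sets_F_all: "sets F_all = Filt_all N r Z"
  unfolding F_all_def Filt_all_def using Filt_Pow by (rule sets_measure_of)

lemma F_F_all: "a \<in> mindices N \<Longrightarrow> A \<in> sets (F a) \<Longrightarrow> A \<in> sets F_all"
  unfolding sets_F sets_F_all Filt_all_def by (intro sigma_sets.Basic) blast

lemma F_all_subset: "sets F_all \<subseteq> sets (prob_sp N)"
  unfolding sets_F_all Filt_all_def
  using F_subset by (intro sets.sigma_sets_subset) (auto simp: sets_F)

lemma F1_eq:
  "F1 N r Z T t = {A \<in> sets F_all. \<forall>a\<in>mindices N.
     A \<inter> {\<omega>\<in>\<Omega> N. below N r T a (r\<^sup>2 * t) \<omega>} \<in> sets (F a)}"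
  unfolding F1_def stopped_sigma_def mindex_le_sigma0 sets_F sets_F_all ..

lemma sigma_algebra_F1:
  assumes "0 \<le> t"
  shows "sigma_algebra (\<Omega> N) (F1 N r Z T t)"
  unfolding sigma_algebra_iff2
proof (intro conjI ballI allI impI)
  let ?S = "\<lambda>a. {\<omega>\<in>\<Omega> N. below N r T a (r\<^sup>2 * t) \<omega>}"
  have S: "?S a \<in> sets (F a)" for a
    using assms by (intro below_stop) simp
  show "F1 N r Z T t \<subseteq> Pow (\<Omega> N)"
    unfolding F1_eq using sets.sets_into_space[of _ F_all] by auto
  show "{} \<in> F1 N r Z T t"
    by (simp add: F1_eq)
  show "\<Omega> N - A \<in> F1 N r Z T t" if A: "A \<in> F1 N r Z T t" for A
  proof -
    have "\<Omega> N - A \<in> sets F_all"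
      using sets.compl_sets[of A F_all] A by (simp add: F1_eq)
    moreover have "(\<Omega> N - A) \<inter> ?S a \<in> sets (F a)" if "a \<in> mindices N" for a
    proof -
      \<comment> \<open>The complement is taken inside the stopping event, which itself lies in
        \<open>F a\<close>.\<close>
      have "?S a - A \<inter> ?S a \<in> sets (F a)"
        using A that S by (intro sets.Diff) (auto simp: F1_eq)
      moreover have "?S a - A \<inter> ?S a = (\<Omega> N - A) \<inter> ?S a"
        by blast
      ultimately show ?thesis by simp
    qed
    ultimately show ?thesis by (simp add: F1_eq)
  qed
  show "(\<Union>n::nat. A n) \<in> F1 N r Z T t" if A: "range A \<subseteq> F1 N r Z T t" for A
  proof -
    have "(\<Union>n. A n) \<in> sets F_all"
      using A by (intro sets.countable_UN) (auto simp: F1_eq)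
    moreover have "(\<Union>n. A n) \<inter> ?S a \<in> sets (F a)" if "a \<in> mindices N" for a
    proof -
      have "(\<Union>n. A n \<inter> ?S a) \<in> sets (F a)"
        using A that by (intro sets.countable_UN) (auto simp: F1_eq)
      then show ?thesis by simp
    qed
    ultimately show ?thesis by (simp add: F1_eq)
  qed
qed

text \<open>On good points the stopping event at \<open>t\<close> is contained in the one at
  \<open>s\<close>, so intersecting with the former factors through the latter. The remaining points
  are absorbed by \<open>F_split\<close>.\<close>

lemma F1_mono:
  assumes "0 \<le> s" and "s \<le> t"
  shows "F1 N r Z T s \<subseteq> F1 N r Z T t"
proof
  fix A assume A: "A \<in> F1 N r Z T s"
  let ?S = "\<lambda>a t. {\<omega>\<in>\<Omega> N. below N r T a (r\<^sup>2 * t) \<omega>}"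
  have le: "0 \<le> r\<^sup>2 * s" "r\<^sup>2 * s \<le> r\<^sup>2 * t"
    using assms by (auto intro: mult_left_mono)
  have A_all: "A \<in> sets F_all"
    using A by (simp add: F1_eq)
  have "A \<inter> ?S a t \<in> sets (F a)" if "a \<in> mindices N" for a
  proof (rule F_split)
    show "A \<inter> ?S a t \<in> sets (prob_sp N)"
      using A_all F_all_subset below_measurable[of "r\<^sup>2 * t" a] le by (intro sets.Int) auto
    have "?S a t \<inter> \<Omega>\<^sub>0 \<subseteq> ?S a s"
      using good_path.below_antimono[OF good _ le] by blast
    then have "A \<inter> ?S a t \<inter> \<Omega>\<^sub>0 = A \<inter> ?S a s \<inter> ?S a t \<inter> \<Omega>\<^sub>0"
      by blast
    moreover have "A \<inter> ?S a s \<inter> ?S a t \<inter> \<Omega>\<^sub>0 \<in> sets (F a)"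
    proof (rule sets.Int[OF sets.Int good_F])
      show "A \<inter> ?S a s \<in> sets (F a)"
        using A that by (simp add: F1_eq)
      show "?S a t \<in> sets (F a)"
        using le by (intro below_stop) linarith
    qed
    ultimately show "A \<inter> ?S a t \<inter> \<Omega>\<^sub>0 \<in> sets (F a)" by simp
  qed
  then show "A \<in> F1 N r Z T t"
    using A_all by (simp add: F1_eq)
qed

lemma filtration_F1: "is_filtration (\<Omega> N) (F1 N r Z T)"
  unfolding is_filtration_def using sigma_algebra_F1 F1_mono by blast

text \<open>Countably many diagonal multi-indices exhaust the sample space. The entries are
  \<open>Suc n\<close> because \<open>below\<close> is strict and multi-indices start at 1.\<close>

lemma ex_diagonal_below:
  "\<exists>n::nat. below N r T ((\<lambda>i\<in>{..<buffers N}. Suc n), (\<lambda>j\<in>{..<activities N}. Suc n)) s \<omega>"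
proof -
  let ?n = "Max (insert 0 ((\<lambda>i. Ecount N r i s \<omega>) ` {..<buffers N} \<union>
     (\<lambda>j. Scount N r j (T j s \<omega>) \<omega>) ` {..<activities N}))"
  have "below N r T ((\<lambda>i\<in>{..<buffers N}. Suc ?n), (\<lambda>j\<in>{..<activities N}. Suc ?n)) s \<omega>"
    by (auto simp: below_def less_Suc_eq_le intro!: Max_ge)
  then show ?thesis by blast
qed

text \<open>The local condition in \<open>F1\<close> is \<open>below_T_stop\<close>; membership in
  \<open>F_all\<close> comes from a countable union along the diagonal.\<close>

lemma T_F1:
  assumes t: "0 \<le> t" and j: "j < activities N"
  shows "T j (r\<^sup>2 * t) \<in> borel_measurable (sigma (\<Omega> N) (F1 N r Z T t))"
proof (rule measurableI)
  let ?s = "r\<^sup>2 * t"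
  have s: "0 \<le> ?s" using t by simp
  interpret F1: sigma_algebra "\<Omega> N" "F1 N r Z T t"
    using t by (rule sigma_algebra_F1)
  fix X :: "real set" assume X: "X \<in> sets borel"
  let ?V = "T j ?s -` X \<inter> \<Omega> N"
  let ?a = "\<lambda>n. ((\<lambda>i\<in>{..<buffers N}. Suc n), (\<lambda>j\<in>{..<activities N}. Suc n))"
  have a: "?a n \<in> mindices N" for n
    by (simp add: mindices_def)
  have "?V = (\<Union>n. ?V \<inter> {\<omega>\<in>\<Omega> N. below N r T (?a n) ?s \<omega>})"
    using ex_diagonal_below[of ?s] by blast
  also have "\<dots> \<in> sets F_all"
    using F_F_all[OF a below_T_stop[OF s j X]] by (intro sets.countable_UN) blast
  finally have "?V \<in> F1 N r Z T t"
    unfolding F1_eq using below_T_stop[OF s j X] by simp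
  then show "T j ?s -` X \<inter> space (sigma (\<Omega> N) (F1 N r Z T t)) \<in> sets (sigma (\<Omega> N) (F1 N r Z T t))"
    by (simp add: F1.space_measure_of_eq F1.sets_measure_of_eq)
qed simp

text \<open>Each component of \<open>Uhat\<close> at \<open>t\<close> is a fixed affine function of
  the allocations at time \<open>r\<^sup>2 * t\<close>.\<close>

lemma adapted_Uhat:
  assumes "basic N \<le> activities N"
  shows "adapted (\<Omega> N) (F1 N r Z T) (servers N + activities N - basic N) (Uhat N r T)"
  unfolding adapted_def
proof (intro allI impI)
  fix t :: real and k assume t: "0 \<le> t" and k: "k < servers N + activities N - basic N"
  have dims: "dim_row (Kmat N) = servers N + activities N - basic N" "dim_col (Kmat N) = activities N"
    using assms by (simp_all add: Kmat_def Let_def)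
  have "Uhat N r T t \<omega> $ k = 1 / r * (\<Sum>j<activities N. Kmat N $$ (k, j) *
      (x_star N $ j * (r\<^sup>2 * t) - T j (r\<^sup>2 * t) \<omega>))" for \<omega>
    using k dims by (simp add: Uhat_def Uproc_def Yproc_def scalar_prod_def lessThan_atLeast0)
  then show "(\<lambda>\<omega>. Uhat N r T t \<omega> $ k) \<in> borel_measurable (sigma (\<Omega> N) (F1 N r Z T t))"
    using T_F1[OF t]
    by (simp only:) (intro borel_measurable_times borel_measurable_sum borel_measurable_diff
      borel_measurable_const; simp)
qed

end

lemma iid_measurable: "prob_space M \<Longrightarrow> iid M L X \<Longrightarrow> 1 \<le> n \<Longrightarrow> X n \<in> measurable M L"
  by (simp add: iid_def prob_space.indep_vars_def2)

theorem theorem5p4: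
  fixes N :: "'w network" and r :: real and T D :: "'w policy"
    and h :: "nat \<Rightarrow> nat \<Rightarrow> (nat \<Rightarrow> snapshot) \<Rightarrow> real"
    and Z :: "'w set set"
  assumes "network_structure N" and "network_primitives N" and "heavy_traffic N"
    and "r \<in> range (rseq N)"
    and "\<And>j t. j < activities N \<Longrightarrow> 0 \<le> t \<Longrightarrow> T j t \<in> borel_measurable (prob_sp N)"
    and "\<And>j. j < activities N \<Longrightarrow>
           (\<lambda>(t, \<omega>). D j t \<omega>) \<in> borel_measurable (restrict_space borel {0..} \<Otimes>\<^sub>M prob_sp N)"
    and "\<And>l j. j < activities N \<Longrightarrow> h l j \<in> borel_measurable (history_space N l)"
    and "AE \<omega> in prob_sp N. feasible_path N r T \<omega>"
    and "AE \<omega> in prob_sp N. feedback_path N r T D h \<omega>"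
    and "Z = null_sets (prob_sp N) \<or>
         Z = {} \<and> (\<forall>\<omega>\<in>\<Omega> N. regular_path N r \<omega> \<and> feasible_path N r T \<omega> \<and> feedback_path N r T D h \<omega>)"
  shows "(\<forall>t\<ge>0. mp_stopping_time N r Z (sigma0 N r T t)) \<and>
         is_filtration (\<Omega> N) (F1 N r Z T) \<and>
         adapted (\<Omega> N) (F1 N r Z T) (servers N + activities N - basic N) (Uhat N r T)"
proof -
  let ?P = "\<lambda>\<omega>. regular_path N r \<omega> \<and> feasible_path N r T \<omega> \<and> feedback_path N r T D h \<omega>"
  have prob: "prob_space (prob_sp N)"
    and prim: "arrival_primitives N r" "service_primitives N r" "routing_primitives N r"
    using assms(2,4) by (auto simp: network_primitives_def)
  obtain \<Omega>\<^sub>0 where good_sets: "\<Omega>\<^sub>0 \<in> sets (prob_sp N)"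
    and bad: "\<And>A. A \<in> sets (prob_sp N) \<Longrightarrow> A \<inter> \<Omega>\<^sub>0 = {} \<Longrightarrow> A \<in> sigma_sets (\<Omega> N) Z"
    and good: "\<And>\<omega>. \<omega> \<in> \<Omega>\<^sub>0 \<Longrightarrow> ?P \<omega>"
    using assms(10)
  proof (elim disjE conjE)
    assume Z: "Z = null_sets (prob_sp N)"
    have "AE \<omega> in prob_sp N. ?P \<omega>"
      using AE_regular_path[OF assms(2,4)] assms(8,9) by eventually_elim simp
    \<comment> \<open>The bad points need not form a measurable set, so a measurable null set
      containing them is removed; its measurable subsets are null and hence in
      \<open>Z\<close>.\<close>
    then obtain N0 where N0: "{\<omega>\<in>\<Omega> N. \<not> ?P \<omega>} \<subseteq> N0" "N0 \<in> null_sets (prob_sp N)"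
      unfolding eventually_ae_filter by blast
    show thesis
    proof (rule that[of "\<Omega> N - N0"])
      show "\<Omega> N - N0 \<in> sets (prob_sp N)"
        using N0(2) by auto
      fix A assume A: "A \<in> sets (prob_sp N)" "A \<inter> (\<Omega> N - N0) = {}"
      then have "A \<subseteq> N0"
        using sets.sets_into_space[OF A(1)] by blast
      then have "A \<in> Z"
        using null_sets_subset[OF N0(2) A(1)] Z by simp
      then show "A \<in> sigma_sets (\<Omega> N) Z"
        by (rule sigma_sets.Basic)
    qed (use N0(1) in blast)
  next
    assume "Z = {}" and P: "\<forall>\<omega>\<in>\<Omega> N. ?P \<omega>"
    \<comment> \<open>With every point good, the whole space serves, and only the empty set misses
      it.\<close>
    show thesis
    proof (rule that[of "\<Omega> N"])
      fix A assume A: "A \<in> sets (prob_sp N)" "A \<inter> \<Omega> N = {}"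
      then have "A = {}"
        using sets.sets_into_space[OF A(1)] by blast
      then show "A \<in> sigma_sets (\<Omega> N) Z"
        by (simp add: sigma_sets.Empty)
    qed (use P in auto)
  qed
  interpret controlled_network N r T D h Z \<Omega>\<^sub>0
  proof (rule controlled_network.intro)
    show "arrival_time N r i n \<in> borel_measurable (prob_sp N)" if "i < exo N" "1 \<le> n" for i n
      using prim(1) that by (intro iid_measurable[OF prob]) (auto simp: arrival_primitives_def)
    show "service_time N r j n \<in> borel_measurable (prob_sp N)" if "j < activities N" "1 \<le> n" for j n
      using prim(2) that by (intro iid_measurable[OF prob]) (auto simp: service_primitives_def)
    show "routing N r j n (Some i) \<in> measurable (prob_sp N) (count_space UNIV)"
      if "i < buffers N" "j < activities N" "1 \<le> n" for i j n
    proof -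
      have d: "Some i \<in> dests N"
        using that by (simp add: dests_def)
      have "routing_vec N r j n \<in> measurable (prob_sp N) (routing_space N)"
        using prim(3) that by (intro iid_measurable[OF prob]) (auto simp: routing_primitives_def)
      from measurable_compose[OF this[unfolded routing_space_def] measurable_component_singleton[OF d]]
      show ?thesis
        using d by (simp add: routing_vec_def)
    qed
    show "T j t \<in> borel_measurable (prob_sp N)" if "j < activities N" "0 \<le> t" for j t
      using that by (rule assms(5))
    show "h l j \<in> borel_measurable (history_space N l)" if "j < activities N" for l j
      using that by (rule assms(7))
    show "Z \<subseteq> sets (prob_sp N)"
      using assms(10) by auto
    show "\<Omega>\<^sub>0 \<in> sets (prob_sp N)"
      by (rule good_sets)
    show "A \<in> sigma_sets (\<Omega> N) Z" if "A \<in> sets (prob_sp N)" "A \<inter> \<Omega>\<^sub>0 = {}" for A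
      using that by (rule bad)
    show "good_path N r T D h \<omega>" if "\<omega> \<in> \<Omega>\<^sub>0" for \<omega>
    proof (rule good_path.intro)
      show "regular_path N r \<omega>" "feasible_path N r T \<omega>" "feedback_path N r T D h \<omega>"
        using good[OF that] by auto
      show "0 < exo N"
        using assms(1,3) by (rule exo_pos)
      show "exo N \<le> buffers N"
        using assms(1) by (simp add: network_structure_def)
      \<comment> \<open>Membership in the space is needed to take the time section of the jointly
        measurable \<open>D\<close>.\<close>
      have "\<omega> \<in> \<Omega> N"
        using that sets.sets_into_space[OF good_sets] by blast
      then show "(\<lambda>t. D j t \<omega>) \<in> borel_measurable (restrict_space borel {0..})"
        if "j < activities N" for j
        using measurable_Pair1[OF assms(6)[OF that]] by simp
    qed
  qed
  have "basic N \<le> activities N"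
    using assms(3) unfolding heavy_traffic_def by blast
  then show ?thesis
    using stopping_time filtration_F1 adapted_Uhat by blast
qed

end
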